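(* Let $\rho>\max\{0,-\alpha\}$, $0<\gamma<\sigma\le 1$, $p>1$, $\frac1p+\frac1q=1$, and suppose $U(\infty)=V(\infty)=\infty$. Let $T_1:L_{p,\Phi_\delta}(\mathbf{R}_+)\to l_{p,\Psi_\beta^{1-p}}$ and $T_2:l_{q,\Psi_\beta}\to L_{q,\Phi_\delta^{1-q}}(\mathbf{R}_+)$ be the operators $$(T_1f)_n:=\int_0^\infty K_\delta(x,n)f(x)\,dx\quad(n\in\mathbf{N}),\qquad (T_2a)(x):=\sum_{n=1}^\infty K_\delta(x,n)a_n\quad(x\in\mathbf{R}_+).$$ Then $T_1$ and $T_2$ are well defined and bounded, and their operator norms $$\|T_1\|:=\sup_{f\ne 0}\frac{\|T_1f\|_{p,\Psi_\beta^{1-p}}}{\|f\|_{p,\Phi_\delta}},\qquad \|T_2\|:=\sup_{a\neq 0}\frac{\|T_2a\|_{q,\Phi_\delta^{1-q}}}{\|a\|_{q,\Psi_\beta}}$$ satisfy $$\|T_1\|=\|T_2\|=k(\sigma)=\frac{2\Gamma(\sigma/\gamma)}{\gamma(2\rho)^{\sigma/\gamma}}\,\zeta\!\left(\frac{\sigma}{\gamma},\frac{\alpha+\rho}{2\rho}\right).$$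
   Context: Setting. $\mathbf{R}_+=(0,\infty)$, $\mathbf{N}=\{1,2,\dots\}$, and $\alpha,\rho,\gamma,\sigma,\beta$ are real. $\{\nu_n\}_{n\ge1}$ is a decreasing (i.e. $\nu_{n+1}\le\nu_n$) sequence of positive reals, $V_n=\sum_{j=1}^n\nu_j$, $V(\infty)=\sum_{j=1}^\infty\nu_j$, and $\beta\le\nu_1/2$. $\mu$ is a positive continuous function on $\mathbf{R}_+$ with $U(x):=\int_0^x\mu(t)\,dt<\infty$ for all $x>0$, and $U(\infty)=\lim_{x\to\infty}U(x)$. $\delta\in\{-1,1\}$ is fixed. Powers such as $U^{s}(x)$ mean $(U(x))^{s}$. Kernel: with $\operatorname{csch}(u)=\frac{2}{e^u-e^{-u}}$ ($u>0$), $$K_\delta(x,n):=\frac{\operatorname{csch}\big(\rho\,U^{\delta\gamma}(x)(V_n-\beta)^\gamma\big)}{e^{\alpha U^{\delta\gamma}(x)(V_n-\beta)^\gamma}}.$$ $\zeta(s,a)=\sum_{k=0}^\infty (k+a)^{-s}$ ($s>1$, $a>0$) is the Hurwitz zeta function, and $k(\sigma):=\int_0^\infty\frac{\operatorname{csch}(\rho t^\gamma)}{e^{\alpha t^\gamma}}t^{\sigma-1}dt$. Weights and spaces: $\Phi_\delta(x):=\frac{U^{p(1-\delta\sigma)-1}(x)}{\mu^{p-1}(x)}$, $\Psi_\beta(n):=\frac{(V_n-\beta)^{q(1-\sigma)-1}}{\nu_{n+1}^{q-1}}$, so that $\Psi_\beta^{1-p}(n)=\frac{\nu_{n+1}}{(V_n-\beta)^{1-p\sigma}}$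 and $\Phi_\delta^{1-q}(x)=\frac{\mu(x)}{U^{1-q\delta\sigma}(x)}$. For $r>1$, a positive weight $w$ on $\mathbf{R}_+$ and a positive weight $\omega$ on $\mathbf{N}$, $L_{r,w}(\mathbf{R}_+)$ is the real normed space of measurable $f$ (modulo a.e. equality) with $\|f\|_{r,w}=\left(\int_0^\infty w(x)|f(x)|^r dx\right)^{1/r}<\infty$, and $l_{r,\omega}$ is the real normed space of sequences $c$ with $\|c\|_{r,\omega}=\left(\sum_{n}\omega(n)|c_n|^r\right)^{1/r}<\infty$. *)

theory Defs
  imports "HOL-Analysis.Analysis"
begin

(* Sequences indexed by {1,2,...} are functions on nat whose value at 0 is never used;
   functions on (0,infinity) are functions on real whose values outside {0<..} are never used. *)

definition partial_V :: "(nat \<Rightarrow> real) \<Rightarrow> nat \<Rightarrow> real" where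
  "partial_V \<nu> n = (\<Sum>j=1..n. \<nu> j)"

definition primitive_U :: "(real \<Rightarrow> real) \<Rightarrow> real \<Rightarrow> real" where
  "primitive_U \<mu> x = (\<integral>t. \<mu> t \<partial>(lebesgue_on {0<..x}))"

definition csch :: "real \<Rightarrow> real" where
  "csch u = 2 / (exp u - exp (- u))"

definition hurwitz_zeta :: "real \<Rightarrow> real \<Rightarrow> real" where
  "hurwitz_zeta s a = (\<Sum>k. (real k + a) powr (- s))"

definition csch_kernel ::
  "real \<Rightarrow> real \<Rightarrow> real \<Rightarrow> real \<Rightarrow> real \<Rightarrow> (real \<Rightarrow> real) \<Rightarrow> (nat \<Rightarrow> real) \<Rightarrow> real \<Rightarrow> nat \<Rightarrow> real" where
  "csch_kernel \<alpha> \<rho> \<gamma> \<beta> \<delta> \<mu> \<nu> x n =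
     csch (\<rho> * primitive_U \<mu> x powr (\<delta> * \<gamma>) * (partial_V \<nu> n - \<beta>) powr \<gamma>) /
     exp (\<alpha> * primitive_U \<mu> x powr (\<delta> * \<gamma>) * (partial_V \<nu> n - \<beta>) powr \<gamma>)"

definition k_const :: "real \<Rightarrow> real \<Rightarrow> real \<Rightarrow> real \<Rightarrow> real" where
  "k_const \<alpha> \<rho> \<gamma> \<sigma> =
     (\<integral>t. csch (\<rho> * t powr \<gamma>) / exp (\<alpha> * t powr \<gamma>) * t powr (\<sigma> - 1) \<partial>(lebesgue_on {0<..}))"

definition weight_Phi :: "real \<Rightarrow> real \<Rightarrow> real \<Rightarrow> (real \<Rightarrow> real) \<Rightarrow> real \<Rightarrow> real" where
  "weight_Phi p \<sigma> \<delta> \<mu> x =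
     primitive_U \<mu> x powr (p * (1 - \<delta> * \<sigma>) - 1) / \<mu> x powr (p - 1)"

definition weight_Psi :: "real \<Rightarrow> real \<Rightarrow> real \<Rightarrow> (nat \<Rightarrow> real) \<Rightarrow> nat \<Rightarrow> real" where
  "weight_Psi q \<sigma> \<beta> \<nu> n =
     (partial_V \<nu> n - \<beta>) powr (q * (1 - \<sigma>) - 1) / \<nu> (n + 1) powr (q - 1)"

(* Representatives of the elements of the weighted Lebesgue space;
   two of them are the same element iff they agree almost everywhere on {0<..}. *)
definition Lw :: "real \<Rightarrow> (real \<Rightarrow> real) \<Rightarrow> (real \<Rightarrow> real) set" where
  "Lw r w = {f \<in> borel_measurable (lebesgue_on {0<..}).
     integrable (lebesgue_on {0<..}) (\<lambda>x. w x * \<bar>f x\<bar> powr r)}"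

definition Lw_norm :: "real \<Rightarrow> (real \<Rightarrow> real) \<Rightarrow> (real \<Rightarrow> real) \<Rightarrow> real" where
  "Lw_norm r w f = (\<integral>x. w x * \<bar>f x\<bar> powr r \<partial>(lebesgue_on {0<..})) powr (1 / r)"

definition lw :: "real \<Rightarrow> (nat \<Rightarrow> real) \<Rightarrow> (nat \<Rightarrow> real) set" where
  "lw r \<omega> = {c. summable (\<lambda>n. \<omega> (Suc n) * \<bar>c (Suc n)\<bar> powr r)}"

definition lw_norm :: "real \<Rightarrow> (nat \<Rightarrow> real) \<Rightarrow> (nat \<Rightarrow> real) \<Rightarrow> real" where
  "lw_norm r \<omega> c = (\<Sum>n. \<omega> (Suc n) * \<bar>c (Suc n)\<bar> powr r) powr (1 / r)"

definition T1 :: "(real \<Rightarrow> nat \<Rightarrow> real) \<Rightarrow> (real \<Rightarrow> real) \<Rightarrow> nat \<Rightarrow> real" where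
  "T1 K f n = (\<integral>x. K x n * f x \<partial>(lebesgue_on {0<..}))"

definition T2 :: "(real \<Rightarrow> nat \<Rightarrow> real) \<Rightarrow> (nat \<Rightarrow> real) \<Rightarrow> real \<Rightarrow> real" where
  "T2 K a x = (\<Sum>n. K x (Suc n) * a (Suc n))"

end

(* Put y = U(x)^delta and w_n = V_n - beta, so that K(x, n) depends only on the product y w_n, and let
   phi(t) = csch(rho t^gamma) exp(-alpha t^gamma) t^(sigma - 1), whose integral over (0, infinity) is k(sigma).

   Upper bound: the Schur test with the powers of y and w_n that make both marginals equal to k(sigma).
   The integral over x is a substitution.  For the sum over n, csch is expanded into a geometric series,
   which exhibits phi as a sum of log-convex functions; by the Hermite-Hadamard inequality
   nu_(n+1) phi(y w_n) is at most the integral of u |-> phi(y u) over an interval of length nu_(n+1) centred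
   at w_n, and these intervals are disjoint in (0, infinity) because nu decreases and beta <= nu_1 / 2.
   The same series, integrated termwise, evaluates k(sigma).

   Lower bound: test T1 with f = mu U^(-1) y^sigma on r / w_N <= y <= 1.  For m <= n < N with w_m >= R,
   (T1 f)_n is at least w_n^(-sigma) times the integral of phi over [r, R], while both the p-th power of the
   norm of f and the sum of nu_(n+1) / w_n grow like log w_N.  Pairing f with the truncated sequence
   nu_(n+1) w_n^(sigma - 1) gives the same bound for T2. *)
theory Submission
  imports Defs
begin

text \<open>The natural extremal for the Schur test is its own weight \<mu> U^(-1) y^\<sigma>, but
  the p-th power of its norm is the integral of dy / y over (0, infinity), which diverges
  logarithmically at both ends. Cutting it to a <= y <= 1 leaves exactly - ln a. Two logarithms are
  then compared as N grows, so every constant coming from r, R and m is lost against them. The sum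
  over n has to be bounded by k(\<sigma>) itself, not by a multiple. Monotonicity of phi would
  suggest intervals of length \<nu>_(n+1) that end at w_n, but for \<beta> > 0 the first of these
  may reach below 0. Centred intervals stay inside (0, infinity) for all \<beta> <= \<nu>_1 / 2, at
  the price of needing convexity. The parameters enter through phi: near 0 it behaves like
  t^(\<sigma> - \<gamma> - 1), so \<gamma> < \<sigma> gives integrability there, which is also the
  condition s > 1 for the zeta series with s = \<sigma> / \<gamma>; convexity uses \<gamma> <= 1 and
  \<sigma> <= 1.\<close>

subsection \<open>The Schur test\<close>

text \<open>Hoelder's inequality for f / s with respect to the measure of density a s, since |f /
  s|^p s = |f|^p s^(1 - p). The hypotheses bound nonnegative integrals, so that integrability of a f
  is part of the conclusion. The proof integrates Young's inequality for h / L and 1, with h = |f| /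
  s and a free scale L, and then chooses L.\<close>

lemma weighted_Hoelder:
  fixes a f s :: "'a \<Rightarrow> real"
  assumes p: "p > 1" and c: "c > 0" and J: "J \<ge> 0"
    and a: "\<And>x. x \<in> space M \<Longrightarrow> a x \<ge> 0" and s: "\<And>x. x \<in> space M \<Longrightarrow> s x > 0"
    and meas [measurable]: "a \<in> borel_measurable M" "f \<in> borel_measurable M" "s \<in> borel_measurable M"
    and as: "(\<integral>\<^sup>+x. ennreal (a x * s x) \<partial>M) \<le> ennreal c"
    and af: "(\<integral>\<^sup>+x. ennreal (a x * \<bar>f x\<bar> powr p * s x powr (1 - p)) \<partial>M) \<le> ennreal J"
  shows "integrable M (\<lambda>x. a x * f x)"
    and "\<bar>\<integral>x. a x * f x \<partial>M\<bar> powr p \<le> c powr (p - 1) * J"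
proof -
  define q where "q = p / (p - 1)"
  have q: "q > 1" "1 / p + 1 / q = 1"
    using p by (auto simp: q_def field_simps)
  have young: "a x * \<bar>f x\<bar> \<le> L powr (1 - p) / p * (a x * \<bar>f x\<bar> powr p * s x powr (1 - p)) + L / q * (a x * s x)"
    if x: "x \<in> space M" and L: "L > 0" for x L
  proof -
    define h where "h = \<bar>f x\<bar> / s x"
    have h: "h \<ge> 0" "\<bar>f x\<bar> = h * s x" using s[OF x] by (auto simp: h_def)
    have "h / L * 1 \<le> (h / L) powr p / p + 1 powr q / q"
      using p q L h by (intro Youngs_inequality) auto
    then have "L * (h / L) \<le> L * ((h / L) powr p / p + 1 / q)"
      using L by (intro mult_left_mono) auto
    then have *: "h \<le> L powr (1 - p) / p * h powr p + L / q"
      using L h by (simp add: powr_divide powr_diff algebra_simps)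
    have "a x * \<bar>f x\<bar> = (a x * s x) * h" using h by simp
    also have "\<dots> \<le> (a x * s x) * (L powr (1 - p) / p * h powr p + L / q)"
      using a[OF x] s[OF x] * by (intro mult_left_mono) auto
    also have "s x * h powr p = \<bar>f x\<bar> powr p * s x powr (1 - p)"
      using s[OF x] by (simp add: h_def powr_divide powr_diff)
    then have "(a x * s x) * (L powr (1 - p) / p * h powr p + L / q)
        = L powr (1 - p) / p * (a x * \<bar>f x\<bar> powr p * s x powr (1 - p)) + L / q * (a x * s x)"
      by (simp add: algebra_simps)
    finally show ?thesis .
  qed
  have bound: "(\<integral>\<^sup>+x. ennreal (norm (a x * f x)) \<partial>M) \<le> ennreal (L powr (1 - p) / p * J + L / q * c)"
    if L: "L > 0" for L
  proof -
    have "(\<integral>\<^sup>+x. ennreal (norm (a x * f x)) \<partial>M)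
        \<le> (\<integral>\<^sup>+x. ennreal (L powr (1 - p) / p) * ennreal (a x * \<bar>f x\<bar> powr p * s x powr (1 - p))
             + ennreal (L / q) * ennreal (a x * s x) \<partial>M)"
    proof (rule nn_integral_mono)
      fix x assume x: "x \<in> space M"
      have "norm (a x * f x) \<le> L powr (1 - p) / p * (a x * \<bar>f x\<bar> powr p * s x powr (1 - p)) + L / q * (a x * s x)"
        using young[OF x L] a[OF x] by (simp add: abs_mult)
      then show "ennreal (norm (a x * f x)) \<le> ennreal (L powr (1 - p) / p) * ennreal (a x * \<bar>f x\<bar> powr p * s x powr (1 - p))
             + ennreal (L / q) * ennreal (a x * s x)"
        using p q L a[OF x] s[OF x]
        by (simp flip: ennreal_mult' ennreal_plus add: ennreal_leI less_imp_le)
    qed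
    also have "\<dots> = ennreal (L powr (1 - p) / p) * (\<integral>\<^sup>+x. ennreal (a x * \<bar>f x\<bar> powr p * s x powr (1 - p)) \<partial>M)
             + ennreal (L / q) * (\<integral>\<^sup>+x. ennreal (a x * s x) \<partial>M)"
      by (subst nn_integral_add) (auto simp: nn_integral_cmult)
    also have "\<dots> \<le> ennreal (L powr (1 - p) / p) * ennreal J + ennreal (L / q) * ennreal c"
      by (intro add_mono mult_left_mono as af) auto
    also have "\<dots> = ennreal (L powr (1 - p) / p * J + L / q * c)"
      using p q L J c by (simp flip: ennreal_mult' ennreal_plus)
    finally show ?thesis .
  qed
  show int: "integrable M (\<lambda>x. a x * f x)"
    using bound[of 1] by (intro integrableI_bounded) (auto intro: le_less_trans)
  let ?I = "\<integral>x. norm (a x * f x) \<partial>M"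
  have I: "?I \<le> L powr (1 - p) / p * J + L / q * c" if L: "L > 0" for L
  proof -
    have "ennreal ?I = (\<integral>\<^sup>+x. ennreal (norm (a x * f x)) \<partial>M)"
      by (rule nn_integral_eq_integral[symmetric]) (use int in auto)
    then have "ennreal ?I \<le> ennreal (L powr (1 - p) / p * J + L / q * c)"
      using bound[OF L] by simp
    then show ?thesis
      using p q L J c by (subst (asm) ennreal_le_iff) auto
  qed
  have "\<bar>\<integral>x. a x * f x \<partial>M\<bar> powr p \<le> c powr (p - 1) * J + e" if e: "e > 0" for e
  proof -
    \<comment> \<open>The best scale satisfies L^p = J / c, which degenerates to L = 0 when J = 0.
      Enlarging J by e / c^(p - 1) keeps L positive and costs exactly e in the final bound.\<close>
    define J' where "J' = J + e / c powr (p - 1)"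
    have J': "J' > 0" "J \<le> J'" using e c J by (auto simp: J'_def add_nonneg_pos)
    define L where "L = (J' / c) powr (1 / p)"
    have L: "L > 0" using J' c by (simp add: L_def)
    have Lp: "L powr p = J' / c" using p J' c by (simp add: L_def powr_powr)
    have eq: "L powr (1 - p) * J' = L * c"
      using L Lp c J' by (simp add: powr_diff)
    have "\<bar>\<integral>x. a x * f x \<partial>M\<bar> \<le> ?I"
      using integral_norm_bound[of M "\<lambda>x. a x * f x"] by simp
    also have "\<dots> \<le> L powr (1 - p) / p * J + L / q * c" by (rule I[OF L])
    also have "\<dots> \<le> L powr (1 - p) / p * J' + L / q * c"
      using p q L c J' by (intro add_mono mult_left_mono) auto
    also have "\<dots> = L * c * (1 / p + 1 / q)"
      using eq by (simp add: field_simps)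
    also have "\<dots> = L * c" using q by simp
    finally have "\<bar>\<integral>x. a x * f x \<partial>M\<bar> powr p \<le> (L * c) powr p"
      using p by (intro powr_mono2) auto
    also have "\<dots> = J' * c powr (p - 1)"
      using L c Lp by (simp add: powr_mult powr_diff)
    also have "\<dots> = c powr (p - 1) * J + e"
      using c by (simp add: J'_def field_simps)
    finally show ?thesis .
  qed
  then show "\<bar>\<integral>x. a x * f x \<partial>M\<bar> powr p \<le> c powr (p - 1) * J"
    by (rule field_le_epsilon)
qed

text \<open>For fixed y the weighted Hoelder inequality with weight s gives |T f(y)|^p <= (C
  t(y))^(p - 1) J(y). Integrating this against \<omega> and exchanging the integrals brings in the
  second marginal, which turns J into the norm integral of f. Both measures are left general because
  the counting measure appears once as N and once as M.\<close>

lemma Schur_test: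
  fixes A :: "'a \<Rightarrow> 'b \<Rightarrow> real" and \<omega> t :: "'b \<Rightarrow> real" and \<phi> s f :: "'a \<Rightarrow> real"
  assumes MN: "pair_sigma_finite M N"
    and p: "p > 1" and C: "C > 0"
    and A: "\<And>x y. x \<in> space M \<Longrightarrow> y \<in> space N \<Longrightarrow> A x y \<ge> 0"
    and A_meas: "case_prod A \<in> borel_measurable (M \<Otimes>\<^sub>M N)"
    and s: "\<And>x. x \<in> space M \<Longrightarrow> s x > 0" "s \<in> borel_measurable M"
    and t: "\<And>y. y \<in> space N \<Longrightarrow> t y > 0" "t \<in> borel_measurable N"
    and \<omega>: "\<And>y. y \<in> space N \<Longrightarrow> \<omega> y > 0" "\<omega> \<in> borel_measurable N"
    and \<phi>: "\<And>x. x \<in> space M \<Longrightarrow> \<phi> x \<ge> 0"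
    and f: "f \<in> borel_measurable M" "integrable M (\<lambda>x. \<phi> x * \<bar>f x\<bar> powr p)"
    and As: "\<And>y. y \<in> space N \<Longrightarrow> (\<integral>\<^sup>+x. ennreal (A x y * s x) \<partial>M) \<le> ennreal (C * t y)"
    and At: "\<And>x. x \<in> space M \<Longrightarrow>
      (\<integral>\<^sup>+y. ennreal (A x y * (\<omega> y * t y powr (p - 1))) \<partial>N) \<le> ennreal (C * (s x powr (p - 1) * \<phi> x))"
  shows "AE y in N. integrable M (\<lambda>x. A x y * f x)"
    and "(\<integral>\<^sup>+y. ennreal (\<omega> y * \<bar>\<integral>x. A x y * f x \<partial>M\<bar> powr p) \<partial>N)
      \<le> ennreal (C powr p * (\<integral>x. \<phi> x * \<bar>f x\<bar> powr p \<partial>M))"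
proof -
  interpret pair_sigma_finite M N by (rule MN)
  note [measurable] = A_meas s(2) t(2) \<omega>(2) f(1)
  define J where "J y = (\<integral>\<^sup>+x. ennreal (A x y * \<bar>f x\<bar> powr p * s x powr (1 - p)) \<partial>M)" for y
  have J_meas [measurable]: "J \<in> borel_measurable N"
    unfolding J_def by measurable
  let ?v = "\<lambda>y. \<omega> y * t y powr (p - 1)"
  have "(\<integral>\<^sup>+y. ennreal (?v y) * J y \<partial>N)
      = (\<integral>\<^sup>+y. \<integral>\<^sup>+x. ennreal (?v y) * ennreal (A x y * \<bar>f x\<bar> powr p * s x powr (1 - p)) \<partial>M \<partial>N)"
    unfolding J_def by (intro nn_integral_cong nn_integral_cmult[symmetric]) measurable
  also have "\<dots> = (\<integral>\<^sup>+x. \<integral>\<^sup>+y. ennreal (?v y) * ennreal (A x y * \<bar>f x\<bar> powr p * s x powr (1 - p)) \<partial>N \<partial>M)"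
    by (rule Fubini') measurable
  also have "\<dots> \<le> (\<integral>\<^sup>+x. ennreal (C * (\<phi> x * \<bar>f x\<bar> powr p)) \<partial>M)"
  proof (rule nn_integral_mono)
    fix x assume x: "x \<in> space M"
    have "(\<integral>\<^sup>+y. ennreal (?v y) * ennreal (A x y * \<bar>f x\<bar> powr p * s x powr (1 - p)) \<partial>N)
        = (\<integral>\<^sup>+y. ennreal (\<bar>f x\<bar> powr p * s x powr (1 - p)) * ennreal (A x y * ?v y) \<partial>N)"
    proof (rule nn_integral_cong)
      fix y assume y: "y \<in> space N"
      show "ennreal (?v y) * ennreal (A x y * \<bar>f x\<bar> powr p * s x powr (1 - p)) =
         ennreal (\<bar>f x\<bar> powr p * s x powr (1 - p)) * ennreal (A x y * ?v y)"
        using A[OF x y] \<omega>(1)[OF y] by (simp flip: ennreal_mult' add: mult_ac)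
    qed
    also have "\<dots> = ennreal (\<bar>f x\<bar> powr p * s x powr (1 - p)) * (\<integral>\<^sup>+y. ennreal (A x y * ?v y) \<partial>N)"
      using x by (intro nn_integral_cmult) measurable
    also have "\<dots> \<le> ennreal (\<bar>f x\<bar> powr p * s x powr (1 - p)) * ennreal (C * (s x powr (p - 1) * \<phi> x))"
      by (intro mult_left_mono At[OF x]) auto
    also have "\<dots> = ennreal (C * (\<phi> x * \<bar>f x\<bar> powr p) * (s x powr (1 - p) * s x powr (p - 1)))"
      using C \<phi>[OF x] by (simp flip: ennreal_mult' add: mult_ac)
    also have "s x powr (1 - p) * s x powr (p - 1) = 1"
      using s(1)[OF x] by (simp flip: powr_add)
    finally show "(\<integral>\<^sup>+y. ennreal (?v y) * ennreal (A x y * \<bar>f x\<bar> powr p * s x powr (1 - p)) \<partial>N)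
        \<le> ennreal (C * (\<phi> x * \<bar>f x\<bar> powr p))"
      by simp
  qed
  also have "\<dots> = ennreal (C * (\<integral>x. \<phi> x * \<bar>f x\<bar> powr p \<partial>M))"
    using f C \<phi> by (subst nn_integral_eq_integral) auto
  finally have vJ: "(\<integral>\<^sup>+y. ennreal (?v y) * J y \<partial>N) \<le> ennreal (C * (\<integral>x. \<phi> x * \<bar>f x\<bar> powr p \<partial>M))" .
  \<comment> \<open>Hoelder applies only where J is finite. A finite integral of J against a
    positive weight ensures this almost everywhere.\<close>
  then have "AE y in N. ennreal (?v y) * J y \<noteq> \<infinity>"
    by (intro nn_integral_noteq_infinite) (auto simp: top_unique)
  then have fin: "AE y in N. J y \<noteq> \<infinity>"
    using AE_space
  proof eventually_elim
    case (elim y)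
    then show ?case using t(1)[of y] \<omega>(1)[of y] by (auto simp: ennreal_mult_top)
  qed
  have H: "integrable M (\<lambda>x. A x y * f x) \<and>
      \<bar>\<integral>x. A x y * f x \<partial>M\<bar> powr p \<le> (C * t y) powr (p - 1) * enn2real (J y)"
    if y: "y \<in> space N" and Jy: "J y \<noteq> \<infinity>" for y
  proof -
    have Am: "(\<lambda>x. A x y) \<in> borel_measurable M" using y by measurable
    have "(\<integral>\<^sup>+x. ennreal (A x y * \<bar>f x\<bar> powr p * s x powr (1 - p)) \<partial>M) \<le> ennreal (enn2real (J y))"
      using Jy by (simp add: J_def less_top)
    from weighted_Hoelder[OF p _ _ _ s(1) Am f(1) s(2) As[OF y] this]
    show ?thesis using C t(1)[OF y] A y by auto
  qed
  show "AE y in N. integrable M (\<lambda>x. A x y * f x)"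
    using fin AE_space by eventually_elim (use H in auto)
  have "(\<integral>\<^sup>+y. ennreal (\<omega> y * \<bar>\<integral>x. A x y * f x \<partial>M\<bar> powr p) \<partial>N)
      \<le> (\<integral>\<^sup>+y. ennreal (C powr (p - 1)) * (ennreal (?v y) * J y) \<partial>N)"
  proof (rule nn_integral_mono_AE)
    show "AE y in N. ennreal (\<omega> y * \<bar>\<integral>x. A x y * f x \<partial>M\<bar> powr p)
        \<le> ennreal (C powr (p - 1)) * (ennreal (?v y) * J y)"
      using fin AE_space
    proof eventually_elim
      case (elim y)
      have "\<omega> y * \<bar>\<integral>x. A x y * f x \<partial>M\<bar> powr p \<le> \<omega> y * ((C * t y) powr (p - 1) * enn2real (J y))"
        using H[OF elim(2,1)] \<omega>(1)[OF elim(2)] by (intro mult_left_mono) auto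
      also have "\<dots> = C powr (p - 1) * (?v y * enn2real (J y))"
        using C t(1)[OF elim(2)] by (simp add: powr_mult)
      finally have "ennreal (\<omega> y * \<bar>\<integral>x. A x y * f x \<partial>M\<bar> powr p) \<le> ennreal (C powr (p - 1) * (?v y * enn2real (J y)))"
        by (rule ennreal_leI)
      also have "\<dots> = ennreal (C powr (p - 1)) * (ennreal (?v y) * ennreal (enn2real (J y)))"
        using \<omega>(1)[OF elim(2)] by (simp add: ennreal_mult')
      finally show ?case using elim(1) by (simp add: less_top)
    qed
  qed
  also have "\<dots> = ennreal (C powr (p - 1)) * (\<integral>\<^sup>+y. ennreal (?v y) * J y \<partial>N)"
    by (intro nn_integral_cmult) measurable
  also have "\<dots> \<le> ennreal (C powr (p - 1)) * ennreal (C * (\<integral>x. \<phi> x * \<bar>f x\<bar> powr p \<partial>M))"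
    by (intro mult_left_mono vJ) auto
  also have "\<dots> = ennreal (C powr p * (\<integral>x. \<phi> x * \<bar>f x\<bar> powr p \<partial>M))"
    using C by (simp flip: ennreal_mult' add: powr_diff)
  finally show "(\<integral>\<^sup>+y. ennreal (\<omega> y * \<bar>\<integral>x. A x y * f x \<partial>M\<bar> powr p) \<partial>N)
      \<le> ennreal (C powr p * (\<integral>x. \<phi> x * \<bar>f x\<bar> powr p \<partial>M))" .
qed

text \<open>Needed for Tonelli on the completed measure; completion keeps the measure of Borel sets,
  so a Borel exhaustion still serves.\<close>

lemma sigma_finite_lebesgue: "sigma_finite_measure (lebesgue :: 'a::euclidean_space measure)"
proof
  obtain A :: "nat \<Rightarrow> 'a set" where A: "range A \<subseteq> sets lborel" "(\<Union>i. A i) = space lborel"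
      "\<And>i. emeasure lborel (A i) \<noteq> \<infinity>"
    using lborel.sigma_finite by blast
  show "\<exists>A :: 'a set set. countable A \<and> A \<subseteq> sets lebesgue \<and> \<Union> A = space lebesgue \<and> (\<forall>a\<in>A. emeasure lebesgue a \<noteq> \<infinity>)"
    using A by (intro exI[of _ "range A"]) (auto simp: emeasure_completion image_subset_iff)
qed

subsection \<open>The csch profile\<close>

text \<open>The absolute value of g' lets the rule cover decreasing substitutions too; these occur
  for \<delta> = -1.\<close>

lemma lebesgue_on_change_of_variables:
  fixes f g :: "real \<Rightarrow> real"
  assumes S: "S \<in> sets lebesgue" and T: "T \<in> sets lebesgue"
    and der: "\<And>x. x \<in> S \<Longrightarrow> (g has_field_derivative g' x) (at x)"
    and bij: "bij_betw g S T"
    and f: "integrable (lebesgue_on T) f"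
  shows "integrable (lebesgue_on S) (\<lambda>x. \<bar>g' x\<bar> * f (g x))"
    and "(\<integral>x. \<bar>g' x\<bar> * f (g x) \<partial>(lebesgue_on S)) = (\<integral>x. f x \<partial>(lebesgue_on T))"
proof -
  have im: "g ` S = T" and inj: "inj_on g S" using bij by (auto simp: bij_betw_def)
  have "f absolutely_integrable_on T"
    using f T by (simp add: set_integrable_def integrable_restrict_space)
  then have *: "(\<lambda>x. \<bar>g' x\<bar> *\<^sub>R f (g x)) absolutely_integrable_on S \<and>
      integral S (\<lambda>x. \<bar>g' x\<bar> *\<^sub>R f (g x)) = integral T f"
    using has_absolute_integral_change_of_variables_1'[OF S _ inj, of g' f "integral T f"] der im
    by (auto intro: has_field_derivative_at_within)
  then show int: "integrable (lebesgue_on S) (\<lambda>x. \<bar>g' x\<bar> * f (g x))"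
    using S by (simp add: set_integrable_def integrable_restrict_space)
  show "(\<integral>x. \<bar>g' x\<bar> * f (g x) \<partial>(lebesgue_on S)) = (\<integral>x. f x \<partial>(lebesgue_on T))"
    using * lebesgue_integral_eq_integral[OF int S] lebesgue_integral_eq_integral[OF f T] by simp
qed

lemma bij_betw_greaterThan_0:
  fixes g :: "real \<Rightarrow> real"
  assumes "\<And>x. x > 0 \<Longrightarrow> g x > 0" "\<And>x. x > 0 \<Longrightarrow> h x > 0"
    "\<And>x. x > 0 \<Longrightarrow> h (g x) = x" "\<And>x. x > 0 \<Longrightarrow> g (h x) = x"
  shows "bij_betw g {0<..} {0<..}"
  by (rule bij_betw_byWitness[where f' = h]) (use assms in auto)

lemma integrable_lebesgue_on_has_integral:
  fixes f :: "real \<Rightarrow> real"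
  assumes S: "S \<in> sets lebesgue" and nonneg: "\<And>x. x \<in> S \<Longrightarrow> f x \<ge> 0" and f: "(f has_integral I) S"
  shows "integrable (lebesgue_on S) f" "(\<integral>x. f x \<partial>(lebesgue_on S)) = I"
proof -
  have "f absolutely_integrable_on S"
    using f nonneg by (intro nonnegative_absolutely_integrable_1) auto
  then show int: "integrable (lebesgue_on S) f"
    using S by (simp add: set_integrable_def integrable_restrict_space)
  show "(\<integral>x. f x \<partial>(lebesgue_on S)) = I"
    using lebesgue_integral_eq_integral[OF int S] f by auto
qed

text \<open>The substitution u = b t^\<gamma> leads to Euler's integral with s = \<sigma> /
  \<gamma>. The rate b stays free because the series of csch produces a different one for each
  term.\<close>

lemma integral_exp_powr:
  fixes b \<gamma> \<sigma> :: real
  assumes b: "b > 0" and \<gamma>: "\<gamma> > 0" and \<sigma>: "\<sigma> > 0"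
  shows "integrable (lebesgue_on {0<..}) (\<lambda>t. exp (- b * t powr \<gamma>) * t powr (\<sigma> - 1))"
    and "(\<integral>t. exp (- b * t powr \<gamma>) * t powr (\<sigma> - 1) \<partial>(lebesgue_on {0<..}))
      = Gamma (\<sigma> / \<gamma>) / \<gamma> * b powr (- (\<sigma> / \<gamma>))"
proof -
  define s where "s = \<sigma> / \<gamma>"
  have s: "s > 0" using \<gamma> \<sigma> by (simp add: s_def)
  define f :: "real \<Rightarrow> real" where "f = (\<lambda>t. t powr (s - 1) / exp t)"
  have "(f has_integral Gamma s) {0..}"
    unfolding f_def by (rule Gamma_integral_real[OF s])
  then have "(f has_integral Gamma s) {0<..}"
    by (subst has_integral_spike_set_eq[where T = "{0..}"])
      (auto intro!: negligible_subset[OF negligible_sing[of 0]])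
  from integrable_lebesgue_on_has_integral[OF _ _ this]
  have f: "integrable (lebesgue_on {0<..}) f" "(\<integral>t. f t \<partial>(lebesgue_on {0<..})) = Gamma s"
    by (auto simp: f_def)
  define g where "g = (\<lambda>t. b * t powr \<gamma>)"
  define g' where "g' = (\<lambda>t. b * (\<gamma> * t powr (\<gamma> - 1)))"
  have bij: "bij_betw g {0<..} {0<..}"
    by (rule bij_betw_greaterThan_0[of _ "\<lambda>u. (u / b) powr (1 / \<gamma>)"])
      (use b \<gamma> in \<open>auto simp: g_def powr_powr\<close>)
  have der: "(g has_field_derivative g' x) (at x)" if "x \<in> {0<..}" for x
    using that unfolding g_def g'_def by (auto intro!: derivative_eq_intros)
  note cv = lebesgue_on_change_of_variables[OF _ _ der bij f(1)]
  have eq: "\<bar>g' x\<bar> * f (g x) = \<gamma> * b powr s * (exp (- b * x powr \<gamma>) * x powr (\<sigma> - 1))" if "x > 0" for x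
  proof -
    have "\<bar>g' x\<bar> * f (g x) = \<gamma> * (b * b powr (s - 1)) * (x powr (\<gamma> - 1) * x powr (\<gamma> * (s - 1))) * exp (- b * x powr \<gamma>)"
      using that b \<gamma> by (simp add: g'_def g_def f_def powr_mult powr_powr exp_minus field_simps)
    also have "b * b powr (s - 1) = b powr s" using b by (simp add: powr_diff)
    also have "x powr (\<gamma> - 1) * x powr (\<gamma> * (s - 1)) = x powr (\<sigma> - 1)"
      using that \<gamma> by (simp add: s_def algebra_simps flip: powr_add)
    finally show ?thesis by (simp add: mult_ac)
  qed
  have "integrable (lebesgue_on {0<..}) (\<lambda>x. \<gamma> * b powr s * (exp (- b * x powr \<gamma>) * x powr (\<sigma> - 1)))"
    using cv(1) by (rule Bochner_Integration.integrable_cong[THEN iffD1, rotated -1]) (auto simp: eq)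
  then show "integrable (lebesgue_on {0<..}) (\<lambda>t. exp (- b * t powr \<gamma>) * t powr (\<sigma> - 1))"
    using b \<gamma> by (simp add: mult.assoc)
  have "Gamma s = (\<integral>x. \<gamma> * b powr s * (exp (- b * x powr \<gamma>) * x powr (\<sigma> - 1)) \<partial>(lebesgue_on {0<..}))"
    using cv(2) unfolding f by (subst Bochner_Integration.integral_cong[OF refl eq[symmetric]]) auto
  then have "Gamma s = \<gamma> * b powr s * (\<integral>x. exp (- b * x powr \<gamma>) * x powr (\<sigma> - 1) \<partial>(lebesgue_on {0<..}))"
    unfolding Bochner_Integration.integral_mult_right_zero .
  then show "(\<integral>t. exp (- b * t powr \<gamma>) * t powr (\<sigma> - 1) \<partial>(lebesgue_on {0<..}))
      = Gamma (\<sigma> / \<gamma>) / \<gamma> * b powr (- (\<sigma> / \<gamma>))"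
    using b \<gamma> by (simp add: s_def powr_minus field_simps)
qed

section \<open>Series, convexity, monotonicity and integral of the profile\<close>

definition csch_exp :: "real \<Rightarrow> real \<Rightarrow> real \<Rightarrow> real \<Rightarrow> real" where
  "csch_exp \<alpha> \<rho> \<gamma> t = csch (\<rho> * t powr \<gamma>) / exp (\<alpha> * t powr \<gamma>)"

lemma csch_exp_measurable [measurable]: "csch_exp \<alpha> \<rho> \<gamma> \<in> borel_measurable borel"
  unfolding csch_exp_def csch_def by measurable

lemma csch_exp_pos: "\<rho> > 0 \<Longrightarrow> t > 0 \<Longrightarrow> csch_exp \<alpha> \<rho> \<gamma> t > 0"
  by (auto simp: csch_exp_def csch_def)

text \<open>With u = \<rho> t^\<gamma>, csch u = 2 e^(-u) / (1 - e^(-2 u)) is a geometric series of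
  ratio e^(-2 u). The rates \<alpha> + (2 j + 1) \<rho> are all positive once \<rho> > max 0 (-
  \<alpha>); convexity, monotonicity and the value of the integral all rest on this.\<close>

lemma csch_exp_sums:
  assumes \<rho>: "\<rho> > 0" and t: "t > 0"
  shows "(\<lambda>j. 2 * exp (- (\<alpha> + (2 * real j + 1) * \<rho>) * t powr \<gamma>)) sums csch_exp \<alpha> \<rho> \<gamma> t"
proof -
  define u where "u = t powr \<gamma>"
  have u: "u > 0" using t by (simp add: u_def)
  have less: "exp (- (2 * \<rho> * u)) < 1" using \<rho> u by simp
  then have "(\<lambda>j. exp (- (2 * \<rho> * u)) ^ j) sums (1 / (1 - exp (- (2 * \<rho> * u))))"
    by (intro geometric_sums) auto
  from sums_mult[OF this, of "2 * exp (- (\<alpha> + \<rho>) * u)"]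
  have "(\<lambda>j. 2 * exp (- (\<alpha> + \<rho>) * u) * exp (- (2 * \<rho> * u)) ^ j) sums
      (2 * exp (- (\<alpha> + \<rho>) * u) * (1 / (1 - exp (- (2 * \<rho> * u)))))" .
  also have "(\<lambda>j. 2 * exp (- (\<alpha> + \<rho>) * u) * exp (- (2 * \<rho> * u)) ^ j)
      = (\<lambda>j. 2 * exp (- (\<alpha> + (2 * real j + 1) * \<rho>) * u))"
    by (auto simp: fun_eq_iff algebra_simps simp flip: exp_of_nat_mult exp_add)
  also have "2 * exp (- (\<alpha> + \<rho>) * u) * (1 / (1 - exp (- (2 * \<rho> * u)))) = csch_exp \<alpha> \<rho> \<gamma> t"
  proof -
    have e: "exp (\<rho> * u) - exp (- (\<rho> * u)) = exp (\<rho> * u) * (1 - exp (- (2 * \<rho> * u)))"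
      by (simp add: algebra_simps flip: exp_add)
    have "- (\<alpha> + \<rho>) * u = - (\<rho> * u + \<alpha> * u)" by (simp add: algebra_simps)
    then have "exp (- (\<alpha> + \<rho>) * u) = exp (- (\<rho> * u + \<alpha> * u))" by (rule arg_cong)
    also have "\<dots> = 1 / (exp (\<rho> * u) * exp (\<alpha> * u))"
      unfolding exp_minus exp_add by (simp add: divide_inverse)
    finally show ?thesis
      unfolding csch_exp_def csch_def u_def[symmetric] e by simp
  qed
  finally show ?thesis by (simp only: u_def)
qed

text \<open>The logarithm is - b t^\<gamma> + (\<sigma> - 1) ln t. Both terms are convex, the first
  because t^\<gamma> is concave for \<gamma> <= 1, the second because \<sigma> <= 1. The exponential
  is increasing and convex, so it preserves convexity.\<close>

lemma exp_powr_convex: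
  fixes b \<gamma> \<sigma> :: real
  assumes b: "b \<ge> 0" and \<gamma>: "0 < \<gamma>" "\<gamma> \<le> 1" and \<sigma>: "\<sigma> \<le> 1"
  shows "convex_on {0<..} (\<lambda>t. exp (- b * t powr \<gamma>) * t powr (\<sigma> - 1))"
proof -
  define h where "h = (\<lambda>t::real. - b * t powr \<gamma> + (\<sigma> - 1) * ln t)"
  have conv: "convex_on {0<..} h"
    unfolding h_def
  proof (rule f''_ge0_imp_convex)
    fix x :: real assume "x \<in> {0<..}"
    then have x: "x > 0" by simp
    show "((\<lambda>t. - b * t powr \<gamma> + (\<sigma> - 1) * ln t) has_real_derivative
        (- b * (\<gamma> * x powr (\<gamma> - 1)) + (\<sigma> - 1) * (1 / x))) (at x)"
      using x by (auto intro!: derivative_eq_intros)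
    show "((\<lambda>x. - b * (\<gamma> * x powr (\<gamma> - 1)) + (\<sigma> - 1) * (1 / x)) has_real_derivative
        (b * \<gamma> * (1 - \<gamma>) * x powr (\<gamma> - 2) + (1 - \<sigma>) / x\<^sup>2)) (at x)"
    proof (rule DERIV_cong)
      show "((\<lambda>x. - b * (\<gamma> * x powr (\<gamma> - 1)) + (\<sigma> - 1) * (1 / x)) has_real_derivative
          - b * (\<gamma> * ((\<gamma> - 1) * x powr (\<gamma> - 1 - 1))) + (\<sigma> - 1) * (- (1 / x\<^sup>2))) (at x)"
        using x by (auto intro!: derivative_eq_intros simp: power2_eq_square diff_divide_distrib)
      show "- b * (\<gamma> * ((\<gamma> - 1) * x powr (\<gamma> - 1 - 1))) + (\<sigma> - 1) * (- (1 / x\<^sup>2))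
          = b * \<gamma> * (1 - \<gamma>) * x powr (\<gamma> - 2) + (1 - \<sigma>) / x\<^sup>2"
        by (simp add: diff_divide_distrib algebra_simps)
    qed
    show "b * \<gamma> * (1 - \<gamma>) * x powr (\<gamma> - 2) + (1 - \<sigma>) / x\<^sup>2 \<ge> 0"
      using b \<gamma> \<sigma> by simp
  qed auto
  have h: "exp (- b * t powr \<gamma>) * t powr (\<sigma> - 1) = exp (h t)" if "t > 0" for t
    using that by (simp add: h_def exp_add exp_diff exp_minus divide_inverse powr_def[of t "\<sigma> - 1"])
  show ?thesis
  proof (rule convex_onI)
    fix t x y :: real assume t: "0 < t" "t < 1" and xy: "x \<in> {0<..}" "y \<in> {0<..}"
    let ?z = "(1 - t) *\<^sub>R x + t *\<^sub>R y"
    have z: "?z > 0" using t xy by (auto intro!: add_pos_pos)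
    have "h ?z \<le> (1 - t) * h x + t * h y"
      using t xy by (intro convex_onD[OF conv]) auto
    then have "exp (h ?z) \<le> exp ((1 - t) *\<^sub>R h x + t *\<^sub>R h y)"
      by simp
    also have "\<dots> \<le> (1 - t) * exp (h x) + t * exp (h y)"
      using t by (intro convex_onD[OF exp_convex]) auto
    finally show "exp (- b * ?z powr \<gamma>) * ?z powr (\<sigma> - 1)
        \<le> (1 - t) * (exp (- b * x powr \<gamma>) * x powr (\<sigma> - 1)) + t * (exp (- b * y powr \<gamma>) * y powr (\<sigma> - 1))"
      using h[OF z] h[of x] h[of y] xy by simp
  qed auto
qed

lemma csch_exp_powr_sums:
  assumes "\<rho> > 0" "t > 0"
  shows "(\<lambda>j. 2 * (exp (- (\<alpha> + (2 * real j + 1) * \<rho>) * t powr \<gamma>) * t powr (\<sigma> - 1)))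
    sums (csch_exp \<alpha> \<rho> \<gamma> t * t powr (\<sigma> - 1))"
  using sums_mult2[OF csch_exp_sums[OF assms, of \<alpha> \<gamma>], of "t powr (\<sigma> - 1)"] by (simp add: mult_ac)

text \<open>A convexity inequality involves only three points, so it passes from the terms to the
  sum of the series by pointwise convergence.\<close>

lemma csch_exp_powr_convex:
  assumes \<rho>: "\<rho> > max 0 (- \<alpha>)" and \<gamma>: "0 < \<gamma>" "\<gamma> \<le> 1" and \<sigma>: "\<sigma> \<le> 1"
  shows "convex_on {0<..} (\<lambda>t. csch_exp \<alpha> \<rho> \<gamma> t * t powr (\<sigma> - 1))"
proof (rule convex_onI)
  fix t x y :: real assume t: "0 < t" "t < 1" and xy: "x \<in> {0<..}" "y \<in> {0<..}"
  define F where "F = (\<lambda>j t. 2 * (exp (- (\<alpha> + (2 * real j + 1) * \<rho>) * t powr \<gamma>) * t powr (\<sigma> - 1)))"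
  have F: "(\<lambda>j. F j u) sums (csch_exp \<alpha> \<rho> \<gamma> u * u powr (\<sigma> - 1))" if "u > 0" for u
    unfolding F_def using that \<rho> by (intro csch_exp_powr_sums) auto
  have conv: "convex_on {0<..} (F j)" for j
    unfolding F_def
  proof (intro convex_on_cmul exp_powr_convex \<gamma> \<sigma>)
    have "\<alpha> + (2 * real j + 1) * \<rho> = (\<alpha> + \<rho>) + 2 * real j * \<rho>" by (simp add: algebra_simps)
    also have "\<dots> \<ge> 0" using \<rho> by auto
    finally show "\<alpha> + (2 * real j + 1) * \<rho> \<ge> 0" .
  qed auto
  have pos: "(1 - t) *\<^sub>R x + t *\<^sub>R y > 0" using t xy by (auto intro!: add_pos_pos)
  show "csch_exp \<alpha> \<rho> \<gamma> ((1 - t) *\<^sub>R x + t *\<^sub>R y) * ((1 - t) *\<^sub>R x + t *\<^sub>R y) powr (\<sigma> - 1)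
      \<le> (1 - t) * (csch_exp \<alpha> \<rho> \<gamma> x * x powr (\<sigma> - 1)) + t * (csch_exp \<alpha> \<rho> \<gamma> y * y powr (\<sigma> - 1))"
  proof (rule sums_le[OF _ F[OF pos] sums_add[OF sums_mult[OF F] sums_mult[OF F]]])
    show "F j ((1 - t) *\<^sub>R x + t *\<^sub>R y) \<le> (1 - t) * F j x + t * F j y" for j
      using t xy by (intro convex_onD[OF conv]) auto
  qed (use xy in auto)
qed auto

text \<open>Every term of the series decreases. Monotonicity allows a single value to be compared
  with the integral over (0, t), which yields the positivity of k(\<sigma>) and a pointwise bound
  for the kernel.\<close>

lemma csch_exp_powr_antimono:
  assumes \<rho>: "\<rho> > max 0 (- \<alpha>)" and \<gamma>: "0 < \<gamma>" and \<sigma>: "\<sigma> \<le> 1" and xy: "0 < x" "x \<le> y"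
  shows "csch_exp \<alpha> \<rho> \<gamma> y * y powr (\<sigma> - 1) \<le> csch_exp \<alpha> \<rho> \<gamma> x * x powr (\<sigma> - 1)"
proof (rule sums_le[OF _ csch_exp_powr_sums csch_exp_powr_sums])
  fix j
  have "\<alpha> + (2 * real j + 1) * \<rho> = (\<alpha> + \<rho>) + 2 * real j * \<rho>" by (simp add: algebra_simps)
  also have "\<dots> \<ge> 0" using \<rho> by auto
  finally have b: "\<alpha> + (2 * real j + 1) * \<rho> \<ge> 0" .
  have "x powr \<gamma> \<le> y powr \<gamma>" using \<gamma> xy by (intro powr_mono2) auto
  then have "exp (- (\<alpha> + (2 * real j + 1) * \<rho>) * y powr \<gamma>) \<le> exp (- (\<alpha> + (2 * real j + 1) * \<rho>) * x powr \<gamma>)"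
    using mult_left_mono[OF _ b, of "x powr \<gamma>" "y powr \<gamma>"]
    by (simp only: exp_le_cancel_iff mult_minus_left neg_le_iff_le)
  moreover have "y powr (\<sigma> - 1) \<le> x powr (\<sigma> - 1)" using \<sigma> xy by (intro powr_mono2') auto
  ultimately show "2 * (exp (- (\<alpha> + (2 * real j + 1) * \<rho>) * y powr \<gamma>) * y powr (\<sigma> - 1))
      \<le> 2 * (exp (- (\<alpha> + (2 * real j + 1) * \<rho>) * x powr \<gamma>) * x powr (\<sigma> - 1))"
    by (intro mult_left_mono mult_mono) auto
qed (use \<rho> xy in auto)

lemma summable_hurwitz_zeta:
  assumes s: "s > 1" and a: "a > 0"
  shows "summable (\<lambda>j. (real j + a) powr (- s))"
proof (rule summable_comparison_test)
  show "\<exists>N. \<forall>n\<ge>N. norm ((real n + a) powr (- s)) \<le> real n powr (- s)"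
    \<comment> \<open>The comparison starts at 1 because \<open>0 powr (- s)\<close> is 0 by
      convention.\<close>
    using s a by (intro exI[of _ 1]) (auto intro!: powr_mono2')
  show "summable (\<lambda>n. real n powr (- s))"
    using s by (simp add: summable_real_powr_iff)
qed

text \<open>Since \<alpha> + (2 j + 1) \<rho> = 2 \<rho> (j + a) with a = (\<alpha> + \<rho>) / (2
  \<rho>), the Gamma integrals of the terms form a Hurwitz series. The terms are nonnegative, so
  convergence of this same series also justifies exchanging sum and integral.\<close>

lemma integral_csch_exp:
  assumes \<rho>: "\<rho> > max 0 (- \<alpha>)" and \<gamma>: "0 < \<gamma>" "\<gamma> < \<sigma>"
  shows "integrable (lebesgue_on {0<..}) (\<lambda>t. csch_exp \<alpha> \<rho> \<gamma> t * t powr (\<sigma> - 1))"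
    and "(\<integral>t. csch_exp \<alpha> \<rho> \<gamma> t * t powr (\<sigma> - 1) \<partial>(lebesgue_on {0<..}))
      = 2 * Gamma (\<sigma> / \<gamma>) / (\<gamma> * (2 * \<rho>) powr (\<sigma> / \<gamma>)) * hurwitz_zeta (\<sigma> / \<gamma>) ((\<alpha> + \<rho>) / (2 * \<rho>))"
proof -
  let ?M = "lebesgue_on {0<..} :: real measure"
  define s a where "s = \<sigma> / \<gamma>" and "a = (\<alpha> + \<rho>) / (2 * \<rho>)"
  have s: "s > 1" and a: "a > 0" and \<sigma>: "\<sigma> > 0" and \<rho>0: "\<rho> > 0" using \<rho> \<gamma> by (auto simp: s_def a_def)
  define F where "F = (\<lambda>j t. 2 * (exp (- (\<alpha> + (2 * real j + 1) * \<rho>) * t powr \<gamma>) * t powr (\<sigma> - 1)))"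
  have b: "\<alpha> + (2 * real j + 1) * \<rho> = 2 * \<rho> * (real j + a)" for j
    using \<rho>0 by (simp add: a_def field_simps)
  have b0: "\<alpha> + (2 * real j + 1) * \<rho> > 0" for j
    unfolding b using \<rho>0 a by simp
  have F_int: "integrable ?M (F j)" for j
    unfolding F_def by (intro integrable_mult_right integral_exp_powr(1) b0 \<gamma> \<sigma>)
  define D where "D = 2 * Gamma s / (\<gamma> * (2 * \<rho>) powr s)"
  have F_val: "(\<integral>t. F j t \<partial>?M) = D * (real j + a) powr (- s)" for j
  proof -
    have "(\<integral>t. F j t \<partial>?M) = 2 * (Gamma s / \<gamma> * (2 * \<rho> * (real j + a)) powr (- s))"
      unfolding F_def s_def using integral_exp_powr(2)[OF b0 \<gamma>(1) \<sigma>, of j] by (simp add: b)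
    also have "(2 * \<rho> * (real j + a)) powr (- s) = (2 * \<rho>) powr (- s) * (real j + a) powr (- s)"
      using \<rho>0 a by (intro powr_mult)
    also have "2 * (Gamma s / \<gamma> * ((2 * \<rho>) powr (- s) * (real j + a) powr (- s))) = D * (real j + a) powr (- s)"
      unfolding D_def powr_minus[of "2 * \<rho>"] by (simp add: divide_inverse)
    finally show ?thesis .
  qed
  have F_norm: "(\<integral>t. norm (F j t) \<partial>?M) = D * (real j + a) powr (- s)" for j
    unfolding F_val[symmetric] by (intro Bochner_Integration.integral_cong) (auto simp: F_def)
  have sumD: "summable (\<lambda>j. \<integral>t. norm (F j t) \<partial>?M)"
    unfolding F_norm by (intro summable_mult summable_hurwitz_zeta s a)
  have F_sums: "(\<lambda>j. F j t) sums (csch_exp \<alpha> \<rho> \<gamma> t * t powr (\<sigma> - 1))" if "t > 0" for t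
    unfolding F_def using that \<rho>0 by (intro csch_exp_powr_sums)
  have AE: "AE t in ?M. summable (\<lambda>j. norm (F j t))"
  proof (rule AE_I2)
    fix t assume "t \<in> space ?M"
    then show "summable (\<lambda>j. norm (F j t))"
      using sums_summable[OF F_sums[of t]] by (simp add: F_def abs_mult)
  qed
  have cong: "(\<Sum>j. F j t) = csch_exp \<alpha> \<rho> \<gamma> t * t powr (\<sigma> - 1)" if "t \<in> space ?M" for t
    using F_sums[of t] that by (auto dest: sums_unique)
  have "integrable ?M (\<lambda>t. \<Sum>j. F j t)"
    by (rule integrable_suminf[OF F_int AE sumD])
  moreover have "integrable ?M (\<lambda>t. \<Sum>j. F j t) \<longleftrightarrow> integrable ?M (\<lambda>t. csch_exp \<alpha> \<rho> \<gamma> t * t powr (\<sigma> - 1))"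
    by (intro Bochner_Integration.integrable_cong refl cong)
  ultimately show "integrable ?M (\<lambda>t. csch_exp \<alpha> \<rho> \<gamma> t * t powr (\<sigma> - 1))" by simp
  have "(\<integral>t. csch_exp \<alpha> \<rho> \<gamma> t * t powr (\<sigma> - 1) \<partial>?M) = (\<integral>t. (\<Sum>j. F j t) \<partial>?M)"
    by (intro Bochner_Integration.integral_cong refl cong[symmetric])
  also have "\<dots> = (\<Sum>j. \<integral>t. F j t \<partial>?M)"
    by (rule integral_suminf[OF F_int AE sumD])
  also have "\<dots> = D * hurwitz_zeta s a"
    unfolding F_val hurwitz_zeta_def by (intro suminf_mult summable_hurwitz_zeta s a)
  finally show "(\<integral>t. csch_exp \<alpha> \<rho> \<gamma> t * t powr (\<sigma> - 1) \<partial>?M)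
      = 2 * Gamma (\<sigma> / \<gamma>) / (\<gamma> * (2 * \<rho>) powr (\<sigma> / \<gamma>)) * hurwitz_zeta (\<sigma> / \<gamma>) ((\<alpha> + \<rho>) / (2 * \<rho>))"
    by (simp add: D_def s_def a_def)
qed

subsection \<open>Sums of midpoint values of a convex function\<close>

text \<open>The linear part is odd about \<open>w\<close> and contributes nothing; this is applied
  to a supporting line.\<close>

lemma has_integral_affine_centred:
  fixes w l m c :: real
  assumes "l \<ge> 0"
  shows "((\<lambda>u. m + c * (u - w)) has_integral (2 * l * m)) {w - l..w + l}"
proof -
  have "((\<lambda>u. m + c * (u - w)) has_integral
      ((m * (w + l) + c * (w + l - w)\<^sup>2 / 2) - (m * (w - l) + c * (w - l - w)\<^sup>2 / 2))) {w - l..w + l}"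
    using assms
    by (intro fundamental_theorem_of_calculus)
      (auto intro!: derivative_eq_intros simp flip: has_real_derivative_iff_has_vector_derivative)
  then show ?thesis by (simp add: algebra_simps)
qed

lemma Hermite_Hadamard_midpoint:
  fixes f :: "real \<Rightarrow> real"
  assumes conv: "convex_on I f" and w: "w \<in> interior I" and l: "l \<ge> 0"
    and sub: "{w - l<..<w + l} \<subseteq> I" and nonneg: "\<And>x. x \<in> I \<Longrightarrow> f x \<ge> 0"
  shows "ennreal (2 * l * f w) \<le> (\<integral>\<^sup>+x. ennreal (f x) \<partial>(lebesgue_on {w - l<..<w + l}))"
proof -
  let ?S = "{w - l<..<w + l}"
  \<comment> \<open>The infimum of the chord slopes to the right of w is the right derivative there,
    hence the slope of a supporting line.\<close>
  define c where "c = Inf ((\<lambda>t. (f w - f t) / (w - t)) ` ({w<..} \<inter> I))"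
  define h where "h u = f w + c * (u - w)" for u
  have supp: "h y \<le> f y" if "y \<in> ?S" for y
    using convex_le_Inf_differential[OF conv w, of y] sub that by (auto simp: h_def c_def)
  have hi: "(h has_integral (2 * l * f w)) ?S"
    using has_integral_affine_centred[OF l, of "f w" c w] unfolding h_def
    by (simp add: has_integral_Icc_iff_Ioo)
  have "h absolutely_integrable_on {w - l..w + l}"
    unfolding h_def by (intro absolutely_integrable_continuous_real continuous_intros)
  then have "h absolutely_integrable_on ?S"
    by (rule set_integrable_subset) auto
  then have int: "integrable (lebesgue_on ?S) h"
    by (simp add: set_integrable_def integrable_restrict_space)
  have "ennreal (2 * l * f w) = ennreal (\<integral>x. h x \<partial>(lebesgue_on ?S))"
    using lebesgue_integral_eq_integral[OF int] integral_unique[OF hi] by simp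
  \<comment> \<open>The supporting line may become negative, where \<open>ennreal\<close> would cut
    it off. Passing to the positive part only enlarges the integral, and the result stays below f
    because f is nonnegative.\<close>
  also have "\<dots> \<le> ennreal (\<integral>x. max 0 (h x) \<partial>(lebesgue_on ?S))"
    using int by (intro ennreal_leI integral_mono) auto
  also have "\<dots> = (\<integral>\<^sup>+x. ennreal (max 0 (h x)) \<partial>(lebesgue_on ?S))"
    using int by (intro nn_integral_eq_integral[symmetric]) auto
  also have "\<dots> \<le> (\<integral>\<^sup>+x. ennreal (f x) \<partial>(lebesgue_on ?S))"
    using supp nonneg sub by (intro nn_integral_mono ennreal_leI) (auto simp: subset_iff)
  finally show ?thesis .
qed

text \<open>The Hermite-Hadamard inequality on disjoint intervals centred at \<open>w n\<close> with
  half-length \<open>l n\<close>. They are open so that the first may begin exactly at 0, as it does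
  for \<beta> = \<nu>_1 / 2 and \<nu>_2 = \<nu>_1. With values in \<open>ennreal\<close>,
  convergence of the sum is obtained along with the bound.\<close>

lemma suminf_midpoint_le_nn_integral:
  fixes f :: "real \<Rightarrow> real" and w l :: "nat \<Rightarrow> real"
  assumes conv: "convex_on {0<..} f" and nonneg: "\<And>x. x > 0 \<Longrightarrow> f x \<ge> 0"
    and meas: "f \<in> borel_measurable borel"
    and l: "\<And>n. l n > 0" and first: "l 0 \<le> w 0"
    and step: "\<And>n. w n + l n \<le> w (Suc n) - l (Suc n)"
  shows "(\<Sum>n. ennreal (2 * l n * f (w n))) \<le> (\<integral>\<^sup>+x. ennreal (f x) \<partial>(lebesgue_on {0<..}))"
proof -
  define S where "S n = {w n - l n<..<w n + l n}" for n
  have less: "w m + l m \<le> w n - l n" if "m < n" for m n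
    using that
  proof (induction n)
    case (Suc n)
    then show ?case using step[of n] l[of n] by (cases "m = n") auto
  qed simp
  have low: "0 \<le> w n - l n" for n
    using less[of 0 n] first l[of 0] by (cases n) auto
  have S_sub: "S n \<subseteq> {0<..}" for n
    using low[of n] by (auto simp: S_def)
  have disj: "disjoint_family S"
    unfolding disjoint_family_on_def
  proof (intro ballI impI)
    fix m n :: nat assume "m \<noteq> n"
    then show "S m \<inter> S n = {}"
      using less[of m n] less[of n m] by (cases m n rule: linorder_cases) (auto simp: S_def)
  qed
  have "(\<Sum>n. ennreal (2 * l n * f (w n))) \<le> (\<Sum>n. \<integral>\<^sup>+x. ennreal (f x) \<partial>(lebesgue_on (S n)))"
  proof (rule suminf_le)
    fix n
    have "w n \<in> interior {0<..}"
      using low[of n] l[of n] by (simp add: interior_open)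
    then show "ennreal (2 * l n * f (w n)) \<le> (\<integral>\<^sup>+x. ennreal (f x) \<partial>(lebesgue_on (S n)))"
      unfolding S_def using l[of n] S_sub[of n] nonneg
      by (intro Hermite_Hadamard_midpoint[OF conv]) (auto simp: S_def)
  qed auto
  also have "\<dots> = (\<Sum>n. \<integral>\<^sup>+x. ennreal (f x) * indicator (S n) x \<partial>lebesgue)"
    by (subst nn_integral_restrict_space) (auto simp: S_def)
  also have "\<dots> = (\<integral>\<^sup>+x. (\<Sum>n. ennreal (f x) * indicator (S n) x) \<partial>lebesgue)"
    using meas by (intro nn_integral_suminf[symmetric]) (auto simp: S_def measurable_completion)
  also have "\<dots> \<le> (\<integral>\<^sup>+x. ennreal (f x) * indicator {0<..} x \<partial>lebesgue)"
  proof (rule nn_integral_mono)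
    fix x
    have "(\<Sum>n. ennreal (f x) * indicator (S n) x) = ennreal (f x) * (\<Sum>n. indicator (S n) x)"
      by simp
    also have "(\<Sum>n. indicator (S n) x :: ennreal) = indicator (\<Union>n. S n) x"
      using suminf_indicator[OF disj] by simp
    also have "ennreal (f x) * \<dots> \<le> ennreal (f x) * indicator {0<..} x"
      using S_sub by (intro mult_left_mono) (auto split: split_indicator)
    finally show "(\<Sum>n. ennreal (f x) * indicator (S n) x) \<le> ennreal (f x) * indicator {0<..} x" .
  qed
  also have "\<dots> = (\<integral>\<^sup>+x. ennreal (f x) \<partial>(lebesgue_on {0<..}))"
    by (subst nn_integral_restrict_space) auto
  finally show ?thesis .
qed

subsection \<open>The primitive as a change of variables\<close>

locale positive_density =
  fixes \<mu> :: "real \<Rightarrow> real"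
  assumes mu_pos: "\<And>x. x > 0 \<Longrightarrow> \<mu> x > 0"
    and mu_continuous: "continuous_on {0<..} \<mu>"
    and U_finite: "\<And>x. x > 0 \<Longrightarrow> integrable (lebesgue_on {0<..x}) \<mu>"
    and U_infinity: "filterlim (primitive_U \<mu>) at_top at_top"
begin

abbreviation "U \<equiv> primitive_U \<mu>"

lemma mu_integrable_on: "x > 0 \<Longrightarrow> \<mu> integrable_on {0..x}"
  and U_eq_integral: "x > 0 \<Longrightarrow> U x = integral {0..x} \<mu>"
proof -
  assume x: "x > 0"
  have "\<mu> integrable_on {0<..x}"
    using U_finite[OF x] by (intro integrable_on_lebesgue_on) auto
  then show "\<mu> integrable_on {0..x}"
    by (rule integrable_spike_set) (auto intro: negligible_subset[OF negligible_sing[of 0]])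
  have "U x = integral {0<..x} \<mu>"
    unfolding primitive_U_def using U_finite[OF x] by (intro lebesgue_integral_eq_integral) auto
  also have "\<dots> = integral {0..x} \<mu>"
    by (rule integral_spike_set) (auto intro: negligible_subset[OF negligible_sing[of 0]])
  finally show "U x = integral {0..x} \<mu>" .
qed

lemma U_has_derivative:
  assumes x: "x > 0"
  shows "(U has_field_derivative \<mu> x) (at x)"
proof -
  \<comment> \<open>\<mu> may be unbounded near 0, so the fundamental theorem is used on a compact
    interval around x; there U differs from the integral of \<mu> from a only by the constant
    \<open>U a\<close>.\<close>
  define a b where "a = x / 2" and "b = 2 * x"
  have ab: "0 < a" "a < x" "x < b" using x by (auto simp: a_def b_def)
  have split: "U t = U a + integral {a..t} \<mu>" if "t \<in> {a<..<b}" for t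
    using that ab Henstock_Kurzweil_Integration.integral_combine[of 0 a t \<mu>] mu_integrable_on[of t]
    by (auto simp: U_eq_integral)
  have "((\<lambda>t. integral {a..t} \<mu>) has_real_derivative \<mu> x) (at x within {a..b})"
    using ab by (intro integral_has_real_derivative continuous_on_subset[OF mu_continuous]) auto
  then have "((\<lambda>t. integral {a..t} \<mu>) has_real_derivative \<mu> x) (at x)"
    using ab by (simp add: at_within_Icc_at)
  then have "((\<lambda>t. U a + integral {a..t} \<mu>) has_real_derivative \<mu> x) (at x)"
    by (auto intro!: derivative_eq_intros)
  then show ?thesis
    by (rule has_field_derivative_transform_within_open[where S = "{a<..<b}"]) (use ab split in auto)
qed

lemma U_strict_mono: "0 < x \<Longrightarrow> x < y \<Longrightarrow> U x < U y"
  by (rule DERIV_pos_imp_increasing[of x y U]) (auto intro!: exI U_has_derivative mu_pos)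

lemma U_pos: "x > 0 \<Longrightarrow> U x > 0"
proof -
  assume x: "x > 0"
  have "0 \<le> U (x / 2)"
    unfolding primitive_U_def using mu_pos by (intro Bochner_Integration.integral_nonneg) (auto simp: less_imp_le)
  also have "\<dots> < U x" using x by (intro U_strict_mono) auto
  finally show "U x > 0" .
qed

lemma U_continuous: "continuous_on {0<..} U"
  using U_has_derivative by (intro DERIV_continuous_on) (auto intro: has_field_derivative_at_within)

text \<open>Small values come from continuity of the indefinite integral at 0, large ones from
  U(infinity) = infinity, and the intermediate value theorem fills the gap.\<close>

lemma U_surj:
  assumes u: "u > 0"
  shows "\<exists>x>0. U x = u"
proof -
  have "continuous_on {0..1} (\<lambda>x. integral {0..x} \<mu>)"
    using mu_integrable_on[of 1] by (intro indefinite_integral_continuous_1) auto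
  then have "((\<lambda>x. integral {0..x} \<mu>) \<longlongrightarrow> integral {0..0} \<mu>) (at 0 within {0..1})"
    unfolding continuous_on_def by (rule bspec) auto
  then have "((\<lambda>x. integral {0..x} \<mu>) \<longlongrightarrow> 0) (at_right 0)"
    by (simp add: at_within_Icc_at_right)
  from order_tendstoD(2)[OF this u] have "eventually (\<lambda>x. integral {0..x} \<mu> < u) (at_right 0)" .
  moreover have "eventually (\<lambda>x::real. x > 0) (at_right 0)"
    by (rule eventually_at_right_less)
  ultimately have "eventually (\<lambda>x. 0 < x \<and> integral {0..x} \<mu> < u) (at_right 0)"
    by eventually_elim auto
  then have "\<exists>a. 0 < a \<and> integral {0..a} \<mu> < u"
    by (rule eventually_happens'[rotated]) simp
  then obtain a where a: "a > 0" "U a < u"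
    using U_eq_integral by auto
  have "eventually (\<lambda>x. U x \<ge> u) at_top"
    using U_infinity by (simp add: filterlim_at_top)
  then have "eventually (\<lambda>x. U x \<ge> u \<and> x \<ge> a) at_top"
    using eventually_ge_at_top[of a] by eventually_elim auto
  then have "\<exists>b. U b \<ge> u \<and> b \<ge> a"
    by (rule eventually_happens'[rotated]) simp
  then obtain b where b: "U b \<ge> u" "b \<ge> a" by auto
  have "\<exists>x\<ge>a. x \<le> b \<and> U x = u"
    using a b by (intro IVT' continuous_on_subset[OF U_continuous]) auto
  then show ?thesis using a by (auto intro: less_le_trans)
qed

lemma bij_betw_U: "bij_betw U {0<..} {0<..}"
  unfolding bij_betw_def
proof
  show "inj_on U {0<..}"
    by (intro strict_mono_on_imp_inj_on strict_mono_onI) (auto intro: U_strict_mono)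
  show "U ` {0<..} = {0<..}"
  proof (intro equalityI subsetI)
    fix u :: real assume "u \<in> {0<..}"
    then show "u \<in> U ` {0<..}" using U_surj[of u] by auto
  qed (use U_pos in auto)
qed

text \<open>For t = w U(x)^\<delta> one has |dt| = w U^(\<delta> - 1) \<mu> dx, because |\<delta>| =
  1. The map is increasing or decreasing according to the sign of \<delta>, but always onto (0,
  infinity).\<close>

lemma U_powr_substitution:
  assumes \<delta>: "\<delta> \<in> {-1, 1}" and w: "w > 0" and h: "integrable (lebesgue_on {0<..}) h"
  shows "integrable (lebesgue_on {0<..}) (\<lambda>x. w * U x powr (\<delta> - 1) * \<mu> x * h (U x powr \<delta> * w))"
    and "(\<integral>x. w * U x powr (\<delta> - 1) * \<mu> x * h (U x powr \<delta> * w) \<partial>(lebesgue_on {0<..}))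
      = (\<integral>t. h t \<partial>(lebesgue_on {0<..}))"
proof -
  define g where "g x = U x powr \<delta> * w" for x
  define g' where "g' x = \<delta> * U x powr (\<delta> - 1) * \<mu> x * w" for x
  have "bij_betw (\<lambda>v. v powr \<delta> * w) {0<..} {0<..}"
    by (rule bij_betw_greaterThan_0[of _ "\<lambda>u. (u / w) powr (1 / \<delta>)"])
      (use w \<delta> in \<open>auto simp: powr_powr\<close>)
  from bij_betw_trans[OF bij_betw_U this] have bij: "bij_betw g {0<..} {0<..}"
    by (simp add: g_def[abs_def] o_def)
  have der: "(g has_field_derivative g' x) (at x)" if "x \<in> {0<..}" for x
    unfolding g_def g'_def using that
    by (intro DERIV_cmult_right DERIV_chain2[OF has_real_derivative_powr] U_has_derivative U_pos) auto
  note cv = lebesgue_on_change_of_variables[OF _ _ der bij h]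
  have eq: "\<bar>g' x\<bar> * h (g x) = w * U x powr (\<delta> - 1) * \<mu> x * h (U x powr \<delta> * w)"
    if "x \<in> space (lebesgue_on {0<..})" for x
    using that \<delta> w mu_pos[of x] by (auto simp: g'_def g_def abs_mult)
  show "integrable (lebesgue_on {0<..}) (\<lambda>x. w * U x powr (\<delta> - 1) * \<mu> x * h (U x powr \<delta> * w))"
    using cv(1) by (subst Bochner_Integration.integrable_cong[OF refl eq[symmetric]]) auto
  show "(\<integral>x. w * U x powr (\<delta> - 1) * \<mu> x * h (U x powr \<delta> * w) \<partial>(lebesgue_on {0<..}))
      = (\<integral>t. h t \<partial>(lebesgue_on {0<..}))"
    by (subst Bochner_Integration.integral_cong[OF refl eq[symmetric]]) (use cv(2) in auto)
qed

lemma mu_measurable [measurable]: "\<mu> \<in> borel_measurable (lebesgue_on {0<..})"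
  using mu_continuous by (rule continuous_imp_measurable_on_sets_lebesgue) auto

lemma U_measurable [measurable]: "U \<in> borel_measurable (lebesgue_on {0<..})"
  using U_continuous by (rule continuous_imp_measurable_on_sets_lebesgue) auto

end

subsection \<open>Marginals of the kernel\<close>

text \<open>The integral over (0, t), where f is at least \<open>f t\<close>, already
  suffices.\<close>

lemma mult_le_integral_antimono:
  fixes f :: "real \<Rightarrow> real"
  assumes f: "integrable (lebesgue_on {0<..}) f"
    and mono: "\<And>x y. 0 < x \<Longrightarrow> x \<le> y \<Longrightarrow> f y \<le> f x" and nonneg: "\<And>x. x > 0 \<Longrightarrow> f x \<ge> 0" and t: "t > 0"
  shows "t * f t \<le> (\<integral>x. f x \<partial>(lebesgue_on {0<..}))"
proof -
  have "((\<lambda>x. f t) has_integral (t * f t)) {0<..<t}"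
    using has_integral_const_real[of "f t" 0 t] t by (simp add: has_integral_Icc_iff_Ioo)
  then have hi: "((\<lambda>x. if x \<in> {0<..<t} then f t else 0) has_integral (t * f t)) {0<..}"
    by (subst has_integral_restrict) auto
  have "(if x \<in> {0<..<t} then f t else 0) \<ge> 0" for x
    using nonneg t by auto
  note h = integrable_lebesgue_on_has_integral[OF _ this hi]
  have "(\<integral>x. (if x \<in> {0<..<t} then f t else 0) \<partial>(lebesgue_on {0<..})) \<le> (\<integral>x. f x \<partial>(lebesgue_on {0<..}))"
    using mono nonneg by (intro integral_mono h(1) f) auto
  then show ?thesis by (subst (asm) h(2)) auto
qed

section \<open>The setting: shifted partial sums, profile and kernel\<close>

locale csch_setting = positive_density \<mu> for \<mu> :: "real \<Rightarrow> real" +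
  fixes \<alpha> \<rho> \<gamma> \<sigma> \<beta> \<delta> p q :: real
    and \<nu> :: "nat \<Rightarrow> real"
  assumes nu_pos: "\<And>n. n \<ge> 1 \<Longrightarrow> \<nu> n > 0"
    and nu_decreasing: "\<And>n. n \<ge> 1 \<Longrightarrow> \<nu> (n + 1) \<le> \<nu> n"
    and beta: "\<beta> \<le> \<nu> 1 / 2"
    and V_infinity: "filterlim (partial_V \<nu>) at_top sequentially"
    and delta: "\<delta> \<in> {-1, 1}"
    and rho: "\<rho> > max 0 (- \<alpha>)"
    and gamma_sigma: "0 < \<gamma>" "\<gamma> < \<sigma>" "\<sigma> \<le> 1"
    and p: "p > 1"
    and conjugate: "1 / p + 1 / q = 1"
begin

abbreviation "K \<equiv> csch_kernel \<alpha> \<rho> \<gamma> \<beta> \<delta> \<mu> \<nu>"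
abbreviation "\<Phi> \<equiv> weight_Phi p \<sigma> \<delta> \<mu>"
abbreviation "\<Psi> \<equiv> weight_Psi q \<sigma> \<beta> \<nu>"
abbreviation "\<Phi>' \<equiv> (\<lambda>x. \<Phi> x powr (1 - q))"
abbreviation "\<Psi>' \<equiv> (\<lambda>n. \<Psi> n powr (1 - p))"
abbreviation "M \<equiv> lebesgue_on {0<..} :: real measure"
abbreviation "C \<equiv> k_const \<alpha> \<rho> \<gamma> \<sigma>"

definition w :: "nat \<Rightarrow> real" where "w n = partial_V \<nu> n - \<beta>"

definition \<phi> :: "real \<Rightarrow> real" where "\<phi> t = csch_exp \<alpha> \<rho> \<gamma> t * t powr (\<sigma> - 1)"

lemma rho_pos: "\<rho> > 0" using rho by simp

lemma q: "q > 1" "q = p / (p - 1)"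
proof -
  have "q \<noteq> 0" using conjugate p by auto
  then show q: "q = p / (p - 1)" using conjugate p by (simp add: field_simps)
  show "q > 1" unfolding q using p by simp
qed

lemma pq: "(p - 1) * (q - 1) = 1" "q * (p - 1) = p" "p * (q - 1) = q"
  using p by (auto simp: q(2) field_simps)

lemma w_Suc: "w (Suc n) = w n + \<nu> (Suc n)"
  by (simp add: w_def partial_V_def)

lemma w_1: "w (Suc 0) \<ge> \<nu> (Suc 0) / 2"
  using beta by (simp add: w_def partial_V_def)

lemma w_pos: "n \<ge> 1 \<Longrightarrow> w n > 0"
proof (induction n rule: dec_induct)
  case base
  show ?case using w_1 nu_pos[of 1] by simp
next
  case (step n)
  then show ?case using nu_pos[of "Suc n"] by (simp add: w_Suc)
qed

lemma w_Suc_pos [simp]: "w (Suc n) > 0" and nu_Suc_pos [simp]: "\<nu> (Suc n) > 0"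
  using w_pos[of "Suc n"] nu_pos[of "Suc n"] by auto

lemma w_Suc_neq_0 [simp]: "w (Suc n) \<noteq> 0" and nu_Suc_neq_0 [simp]: "\<nu> (Suc n) \<noteq> 0"
  using w_Suc_pos[of n] nu_Suc_pos[of n] by (auto simp del: w_Suc_pos nu_Suc_pos)

lemma w_mono: "m \<le> n \<Longrightarrow> w m \<le> w n"
proof (induction n rule: dec_induct)
  case (step n)
  then show ?case by (simp add: w_Suc add_increasing2 less_imp_le)
qed simp

lemma w_at_top: "filterlim w at_top sequentially"
proof -
  have "filterlim (\<lambda>n. - \<beta> + partial_V \<nu> n) at_top sequentially"
    by (intro filterlim_tendsto_add_at_top[OF tendsto_const] V_infinity)
  then show ?thesis by (simp add: w_def[abs_def])
qed

lemma phi_integrable: "integrable M \<phi>"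
  and phi_integral: "(\<integral>t. \<phi> t \<partial>M) = C"
  using integral_csch_exp(1)[OF rho gamma_sigma(1,2)]
  by (auto simp: \<phi>_def[abs_def] k_const_def csch_exp_def)

lemma phi_measurable [measurable]: "\<phi> \<in> borel_measurable borel"
  unfolding \<phi>_def by measurable

lemma phi_pos: "t > 0 \<Longrightarrow> \<phi> t > 0"
  using rho_pos by (simp add: \<phi>_def csch_exp_pos)

lemma phi_antimono: "0 < x \<Longrightarrow> x \<le> y \<Longrightarrow> \<phi> y \<le> \<phi> x"
  unfolding \<phi>_def by (rule csch_exp_powr_antimono[OF rho gamma_sigma(1,3)])

lemma C_pos: "C > 0"
proof -
  have "0 < 1 * \<phi> 1" by (simp add: phi_pos)
  also have "\<dots> \<le> C"
    unfolding phi_integral[symmetric]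
    by (intro mult_le_integral_antimono phi_integrable phi_antimono) (auto intro: less_imp_le phi_pos)
  finally show ?thesis .
qed

lemma K_eq:
  assumes "x > 0" "n \<ge> 1"
  shows "K x n = csch_exp \<alpha> \<rho> \<gamma> (U x powr \<delta> * w n)"
proof -
  have "(U x powr \<delta> * w n) powr \<gamma> = U x powr (\<delta> * \<gamma>) * w n powr \<gamma>"
    using U_pos[OF assms(1)] w_pos[OF assms(2)] by (simp add: powr_mult powr_powr)
  then show ?thesis by (simp add: csch_kernel_def csch_exp_def w_def mult.assoc)
qed

lemma K_pos: "x > 0 \<Longrightarrow> n \<ge> 1 \<Longrightarrow> K x n > 0"
  using rho_pos U_pos[of x] w_pos[of n] by (simp add: K_eq csch_exp_pos)

text \<open>Splits off the power (y w_n)^(1 - \<sigma>), leaving the integrable profile whose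
  integral is k(\<sigma>).\<close>

lemma K_eq_phi:
  assumes "x > 0" "n \<ge> 1"
  shows "K x n = \<phi> (U x powr \<delta> * w n) * (U x powr (\<delta> * (1 - \<sigma>)) * w n powr (1 - \<sigma>))"
proof -
  define y where "y = U x powr \<delta> * w n"
  have y: "y > 0" using U_pos[OF assms(1)] w_pos[OF assms(2)] by (simp add: y_def)
  have "U x powr (\<delta> * (1 - \<sigma>)) * w n powr (1 - \<sigma>) = y powr (1 - \<sigma>)"
    using U_pos[OF assms(1)] w_pos[OF assms(2)] by (simp add: y_def powr_mult powr_powr)
  moreover have "y powr (\<sigma> - 1) * y powr (1 - \<sigma>) = 1"
    using y by (simp flip: powr_add)
  ultimately show ?thesis
    by (simp add: K_eq[OF assms] \<phi>_def y_def[symmetric] mult.assoc)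
qed

lemma K_measurable [measurable]: "(\<lambda>x. K x n) \<in> borel_measurable M"
  unfolding csch_kernel_def csch_def by measurable

text \<open>The factor h(U^\<delta>) lets one substitution serve twice: h = 1 gives the marginal in
  x, and the indicator of [a, 1] gives T1 at the extremal function.\<close>

lemma kernel_column_substitution:
  assumes n: "n \<ge> 1" and h: "integrable M (\<lambda>t. \<phi> t * h (t / w n))"
  shows "integrable M (\<lambda>x. K x n * (\<mu> x * U x powr (\<delta> * \<sigma> - 1) * h (U x powr \<delta>)))"
    and "(\<integral>x. K x n * (\<mu> x * U x powr (\<delta> * \<sigma> - 1) * h (U x powr \<delta>)) \<partial>M)
      = w n powr (- \<sigma>) * (\<integral>t. \<phi> t * h (t / w n) \<partial>M)"
proof -
  note sub = U_powr_substitution[OF delta w_pos[OF n] h]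
  have eq: "K x n * (\<mu> x * U x powr (\<delta> * \<sigma> - 1) * h (U x powr \<delta>))
      = w n powr (- \<sigma>) * (w n * U x powr (\<delta> - 1) * \<mu> x * (\<phi> (U x powr \<delta> * w n) * h (U x powr \<delta> * w n / w n)))"
    if "x \<in> space M" for x
  proof -
    have x: "x > 0" using that by simp
    have "w n powr (- \<sigma>) * w n = w n powr (1 - \<sigma>)"
      using w_pos[OF n] by (simp add: powr_diff powr_minus field_simps)
    moreover have "U x powr (\<delta> * (1 - \<sigma>)) * U x powr (\<delta> * \<sigma> - 1) = U x powr (\<delta> - 1)"
      using U_pos[OF x] by (simp add: algebra_simps flip: powr_add)
    ultimately show ?thesis
      using w_pos[OF n] unfolding K_eq_phi[OF x n]
      by (simp add: mult_ac)
  qed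
  have "integrable M (\<lambda>x. K x n * (\<mu> x * U x powr (\<delta> * \<sigma> - 1) * h (U x powr \<delta>)))
    \<longleftrightarrow> integrable M (\<lambda>x. w n powr (- \<sigma>) * (w n * U x powr (\<delta> - 1) * \<mu> x * (\<phi> (U x powr \<delta> * w n) * h (U x powr \<delta> * w n / w n))))"
    by (intro Bochner_Integration.integrable_cong refl eq)
  then show "integrable M (\<lambda>x. K x n * (\<mu> x * U x powr (\<delta> * \<sigma> - 1) * h (U x powr \<delta>)))"
    using integrable_mult_right[OF sub(1)] by blast
  have "(\<integral>x. K x n * (\<mu> x * U x powr (\<delta> * \<sigma> - 1) * h (U x powr \<delta>)) \<partial>M)
    = (\<integral>x. w n powr (- \<sigma>) * (w n * U x powr (\<delta> - 1) * \<mu> x * (\<phi> (U x powr \<delta> * w n) * h (U x powr \<delta> * w n / w n))) \<partial>M)"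
    by (intro Bochner_Integration.integral_cong refl eq)
  also have "\<dots> = w n powr (- \<sigma>) * (\<integral>t. \<phi> t * h (t / w n) \<partial>M)"
    unfolding sub(2)[symmetric] by (rule Bochner_Integration.integral_mult_right_zero)
  finally show "(\<integral>x. K x n * (\<mu> x * U x powr (\<delta> * \<sigma> - 1) * h (U x powr \<delta>)) \<partial>M)
      = w n powr (- \<sigma>) * (\<integral>t. \<phi> t * h (t / w n) \<partial>M)" .
qed

text \<open>This marginal is exact; in the Schur test only the sum over n is estimated.\<close>

lemma kernel_column_integral:
  assumes n: "n \<ge> 1"
  shows "(\<integral>\<^sup>+x. ennreal (K x n * (\<mu> x * U x powr (\<delta> * \<sigma> - 1))) \<partial>M) = ennreal (C * w n powr (- \<sigma>))"
proof -
  have int: "integrable M (\<lambda>t. \<phi> t * 1)" using phi_integrable by simp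
  note sub = kernel_column_substitution[OF n int]
  have "(\<integral>\<^sup>+x. ennreal (K x n * (\<mu> x * U x powr (\<delta> * \<sigma> - 1))) \<partial>M)
      = ennreal (\<integral>x. K x n * (\<mu> x * U x powr (\<delta> * \<sigma> - 1) * 1) \<partial>M)"
    using sub(1) K_pos[OF _ n] mu_pos
    by (subst nn_integral_eq_integral[symmetric]) (auto intro!: mult_nonneg_nonneg simp: less_imp_le)
  then show ?thesis unfolding sub(2) by (simp add: phi_integral mult.commute)
qed

text \<open>Scaling by y = U^\<delta> puts the centres at y w_n with half-lengths y \<nu>_(n+1) / 2.
  Neighbouring intervals do not overlap, because w_(n+1) - w_n = \<nu>_(n+1) >= (\<nu>_(n+1) +
  \<nu>_(n+2)) / 2. Position n of the sum stands for index n + 1, so its length weight is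
  \<open>\<nu> (Suc (Suc n))\<close>.\<close>

lemma kernel_row_sum:
  assumes x: "x > 0"
  shows "(\<Sum>n. ennreal (K x (Suc n) * (\<nu> (Suc (Suc n)) * w (Suc n) powr (\<sigma> - 1)))) \<le> ennreal (C * U x powr (- (\<delta> * \<sigma>)))"
proof -
  define y where "y = U x powr \<delta>"
  have y: "y > 0" using U_pos[OF x] by (simp add: y_def)
  have "(\<Sum>n. ennreal (2 * (y * \<nu> (Suc (Suc n)) / 2) * \<phi> (y * w (Suc n)))) \<le> (\<integral>\<^sup>+t. ennreal (\<phi> t) \<partial>M)"
  proof (rule suminf_midpoint_le_nn_integral)
    show "convex_on {0<..} \<phi>"
      unfolding \<phi>_def[abs_def] using gamma_sigma by (intro csch_exp_powr_convex rho) auto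
    show "\<phi> t \<ge> 0" if "t > 0" for t using phi_pos[OF that] by simp
    show "\<phi> \<in> borel_measurable borel" by measurable
    show "y * \<nu> (Suc (Suc n)) / 2 > 0" for n using y by simp
    \<comment> \<open>The left end of the first interval: w_1 >= \<nu>_1 / 2 >= \<nu>_2 / 2, the
      first inequality being the bound on \<beta>.\<close>
    show "y * \<nu> (Suc (Suc 0)) / 2 \<le> y * w (Suc 0)"
      using w_1 nu_decreasing[of 1] y by simp
    show "y * w (Suc n) + y * \<nu> (Suc (Suc n)) / 2 \<le> y * w (Suc (Suc n)) - y * \<nu> (Suc (Suc (Suc n))) / 2" for n
    proof -
      have "y * \<nu> (Suc (Suc (Suc n))) \<le> y * \<nu> (Suc (Suc n))"
        using nu_decreasing[of "Suc (Suc n)"] y by (intro mult_left_mono) auto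
      then show ?thesis unfolding w_Suc[of "Suc n"] distrib_left by linarith
    qed
  qed
  also have "(\<integral>\<^sup>+t. ennreal (\<phi> t) \<partial>M) = ennreal C"
    using phi_integrable phi_pos
    by (subst nn_integral_eq_integral) (auto simp: phi_integral less_imp_le)
  finally have le: "(\<Sum>n. ennreal (2 * (y * \<nu> (Suc (Suc n)) / 2) * \<phi> (y * w (Suc n)))) \<le> ennreal C" .
  have eq: "K x (Suc n) * (\<nu> (Suc (Suc n)) * w (Suc n) powr (\<sigma> - 1))
      = U x powr (- (\<delta> * \<sigma>)) * (2 * (y * \<nu> (Suc (Suc n)) / 2) * \<phi> (y * w (Suc n)))" for n
  proof -
    have "w (Suc n) powr (1 - \<sigma>) * w (Suc n) powr (\<sigma> - 1) = 1"
      by (simp flip: powr_add)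
    moreover have "U x powr (- (\<delta> * \<sigma>)) * y = U x powr (\<delta> * (1 - \<sigma>))"
      using U_pos[OF x] by (simp add: y_def algebra_simps flip: powr_add)
    ultimately show ?thesis
      using K_eq_phi[OF x, of "Suc n"] by (simp add: mult_ac y_def[symmetric])
  qed
  have "(\<Sum>n. ennreal (K x (Suc n) * (\<nu> (Suc (Suc n)) * w (Suc n) powr (\<sigma> - 1))))
      = (\<Sum>n. ennreal (U x powr (- (\<delta> * \<sigma>))) * ennreal (2 * (y * \<nu> (Suc (Suc n)) / 2) * \<phi> (y * w (Suc n))))"
    unfolding eq by (simp add: ennreal_mult')
  also have "\<dots> = ennreal (U x powr (- (\<delta> * \<sigma>))) * (\<Sum>n. ennreal (2 * (y * \<nu> (Suc (Suc n)) / 2) * \<phi> (y * w (Suc n))))"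
    by (rule ennreal_suminf_cmult)
  also have "\<dots> \<le> ennreal (U x powr (- (\<delta> * \<sigma>))) * ennreal C"
    by (intro mult_left_mono le) auto
  also have "\<dots> = ennreal (C * U x powr (- (\<delta> * \<sigma>)))"
    using C_pos by (simp add: mult.commute flip: ennreal_mult')
  finally show ?thesis .
qed

text \<open>This is y phi(y) <= k(\<sigma>) at y = U^\<delta> w_n. The bound is uniform in n and
  gives convergence of the series of T2 at every x, where the Schur test would give it only almost
  everywhere.\<close>

lemma kernel_pointwise_bound:
  assumes x: "x > 0" and n: "n \<ge> 1"
  shows "K x n * w n powr \<sigma> \<le> C * U x powr (- (\<delta> * \<sigma>))"
proof -
  define y where "y = U x powr \<delta> * w n"
  have y: "y > 0" using U_pos[OF x] w_pos[OF n] by (simp add: y_def)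
  have "y * \<phi> y \<le> C"
    unfolding phi_integral[symmetric] using y
    by (intro mult_le_integral_antimono phi_integrable phi_antimono) (auto intro: less_imp_le phi_pos)
  then have "U x powr (- (\<delta> * \<sigma>)) * (y * \<phi> y) \<le> U x powr (- (\<delta> * \<sigma>)) * C"
    by (intro mult_left_mono) auto
  also have "U x powr (- (\<delta> * \<sigma>)) * (y * \<phi> y) = K x n * w n powr \<sigma>"
  proof -
    have "U x powr (- (\<delta> * \<sigma>)) * U x powr \<delta> = U x powr (\<delta> * (1 - \<sigma>))"
      using U_pos[OF x] by (simp add: algebra_simps flip: powr_add)
    moreover have "w n powr (1 - \<sigma>) * w n powr \<sigma> = w n"
      using w_pos[OF n] by (simp flip: powr_add)
    ultimately show ?thesis
      unfolding K_eq_phi[OF x n] y_def[symmetric] by (simp add: y_def mult_ac)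
  qed
  finally show ?thesis by (simp add: mult.commute)
qed

end

subsection \<open>Boundedness of the operators\<close>

lemma suminf_le_of_ennreal:
  assumes "\<And>n. g n \<ge> 0" "B \<ge> 0" "(\<Sum>n. ennreal (g n)) \<le> ennreal B"
  shows "summable g" "suminf g \<le> B"
proof -
  have "(\<Sum>n. ennreal (g n)) \<noteq> top"
    using assms(3) by (metis ennreal_neq_top top_unique)
  with assms(1) show g: "summable g"
    by (rule summable_suminf_not_top)
  have "ennreal (suminf g) \<le> ennreal B"
    using assms(3) unfolding suminf_ennreal2[OF assms(1) g] .
  then show "suminf g \<le> B"
    using ennreal_le_iff[OF assms(2)] by (rule iffD1[rotated])
qed

context csch_setting
begin

lemma Psi'_eq: "n \<ge> 1 \<Longrightarrow> \<Psi>' n = \<nu> (n + 1) * w n powr (p * \<sigma> - 1)"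
proof -
  assume n: "n \<ge> 1"
  have nu: "\<nu> (n + 1) > 0" by simp
  have e1: "(q - 1) * (1 - p) = - 1" using pq(1) by (simp add: algebra_simps)
  have e2: "(q * (1 - \<sigma>) - 1) * (1 - p) = p * \<sigma> - 1"
  proof -
    have "(q * (1 - \<sigma>) - 1) * (1 - p) = - (q * (p - 1)) * (1 - \<sigma>) - (1 - p)"
      by (simp add: algebra_simps)
    then show ?thesis unfolding pq(2) by (simp add: algebra_simps)
  qed
  have "\<Psi>' n = w n powr ((q * (1 - \<sigma>) - 1) * (1 - p)) / \<nu> (n + 1) powr ((q - 1) * (1 - p))"
    by (simp add: weight_Psi_def w_def powr_divide powr_powr)
  then show "\<Psi>' n = \<nu> (n + 1) * w n powr (p * \<sigma> - 1)"
    unfolding e1 e2 using nu by (simp add: powr_minus divide_inverse mult.commute abs_of_pos[OF nu_Suc_pos])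
qed

lemma Phi'_eq: "x > 0 \<Longrightarrow> \<Phi>' x = \<mu> x * U x powr (q * (\<delta> * \<sigma>) - 1)"
proof -
  assume x: "x > 0"
  have e1: "(p - 1) * (1 - q) = - 1" using pq(1) by (simp add: algebra_simps)
  have e2: "(p * (1 - \<delta> * \<sigma>) - 1) * (1 - q) = q * (\<delta> * \<sigma>) - 1"
  proof -
    have "(p * (1 - \<delta> * \<sigma>) - 1) * (1 - q) = - (p * (q - 1)) * (1 - \<delta> * \<sigma>) - (1 - q)"
      by (simp add: algebra_simps)
    then show ?thesis unfolding pq(3) by (simp add: algebra_simps)
  qed
  have "\<Phi>' x = U x powr ((p * (1 - \<delta> * \<sigma>) - 1) * (1 - q)) / \<mu> x powr ((p - 1) * (1 - q))"
    using mu_pos[OF x] by (simp add: weight_Phi_def powr_divide powr_powr)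
  then show "\<Phi>' x = \<mu> x * U x powr (q * (\<delta> * \<sigma>) - 1)"
    unfolding e1 e2 using mu_pos[OF x] by (simp add: powr_minus divide_inverse mult.commute)
qed

lemma Phi_pos: "x > 0 \<Longrightarrow> \<Phi> x > 0"
  using U_pos[of x] mu_pos[of x] by (simp add: weight_Phi_def)

lemma Psi_pos: "n \<ge> 1 \<Longrightarrow> \<Psi> n > 0"
  using w_pos[of n] by (simp add: weight_Psi_def w_def[symmetric])

lemma Phi_measurable [measurable]: "\<Phi> \<in> borel_measurable M"
  unfolding weight_Phi_def by measurable

lemma sigma_finite_M: "sigma_finite_measure M"
  by (intro sigma_finite_measure_restrict_space sigma_finite_lebesgue) auto

lemma sigma_finite_nat: "sigma_finite_measure (count_space (UNIV :: nat set))"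
  by (rule sigma_finite_measure_count_space)

text \<open>One factor is countable, so measurability of each section in x is enough.\<close>

lemma kernel_measurable_pair:
  "(\<lambda>(x, n). K x (Suc n)) \<in> borel_measurable (M \<Otimes>\<^sub>M count_space UNIV)"
  "(\<lambda>(n, x). K x (Suc n)) \<in> borel_measurable (count_space UNIV \<Otimes>\<^sub>M M)"
proof -
  show *: "(\<lambda>(x, n). K x (Suc n)) \<in> borel_measurable (M \<Otimes>\<^sub>M count_space UNIV)"
    unfolding case_prod_beta
    by (rule measurable_compose_countable[where g = snd and f = "\<lambda>n z. K (fst z) (Suc n)"])
      (auto intro: measurable_compose[OF measurable_fst K_measurable])
  show "(\<lambda>(n, x). K x (Suc n)) \<in> borel_measurable (count_space UNIV \<Otimes>\<^sub>M M)"
    using measurable_pair_swap[OF *] by simp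
qed

text \<open>The Schur weights are s = \<mu> U^(\<delta> \<sigma> - 1) and t = w_n^(-\<sigma>). For
  them \<open>\<Psi>'\<close> t^(p - 1) = \<nu>_(n+1) w_n^(\<sigma> - 1) and s^(p - 1) \<Phi> =
  U^(-\<delta> \<sigma>), so the two conditions of the test are exactly the two marginals of the
  kernel.\<close>

lemma T1_bounded:
  assumes f: "f \<in> Lw p \<Phi>"
  shows "\<And>n. n \<ge> 1 \<Longrightarrow> integrable M (\<lambda>x. K x n * f x)"
    and "T1 K f \<in> lw p \<Psi>'"
    and "lw_norm p \<Psi>' (T1 K f) \<le> C * Lw_norm p \<Phi> f"
proof -
  define s where "s x = \<mu> x * U x powr (\<delta> * \<sigma> - 1)" for x
  define t where "t n = w (Suc n) powr (- \<sigma>)" for n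
  define I where "I = (\<integral>x. \<Phi> x * \<bar>f x\<bar> powr p \<partial>M)"
  have f': "f \<in> borel_measurable M" "integrable M (\<lambda>x. \<Phi> x * \<bar>f x\<bar> powr p)"
    using f by (auto simp: Lw_def)
  have I: "I \<ge> 0" unfolding I_def by (intro Bochner_Integration.integral_nonneg) (auto intro!: mult_nonneg_nonneg less_imp_le[OF Phi_pos])
  interpret pair_sigma_finite M "count_space (UNIV :: nat set)"
    by (intro pair_sigma_finite.intro sigma_finite_M sigma_finite_nat)
  have row: "(\<integral>\<^sup>+n. ennreal (K x (Suc n) * (\<Psi>' (Suc n) * t n powr (p - 1))) \<partial>count_space UNIV)
      \<le> ennreal (C * (s x powr (p - 1) * \<Phi> x))" if "x \<in> space M" for x
  proof -
    have x: "x > 0" using that by simp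
    have 1: "\<Psi>' (Suc n) * t n powr (p - 1) = \<nu> (Suc (Suc n)) * w (Suc n) powr (\<sigma> - 1)" for n
    proof -
      have "w (Suc n) powr (p * \<sigma> - 1) * w (Suc n) powr (- \<sigma> * (p - 1)) = w (Suc n) powr (\<sigma> - 1)"
        by (simp add: algebra_simps flip: powr_add)
      then show ?thesis by (simp add: Psi'_eq t_def powr_powr)
    qed
    have 2: "s x powr (p - 1) * \<Phi> x = U x powr (- (\<delta> * \<sigma>))"
    proof -
      have "U x powr ((\<delta> * \<sigma> - 1) * (p - 1)) * U x powr (p * (1 - \<delta> * \<sigma>) - 1) = U x powr (- (\<delta> * \<sigma>))"
        using U_pos[OF x] by (simp add: algebra_simps flip: powr_add)
      then show ?thesis
        using mu_pos[OF x] by (simp add: s_def weight_Phi_def powr_mult powr_powr)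
    qed
    show ?thesis
      unfolding 1 2 nn_integral_count_space_nat by (rule kernel_row_sum[OF x])
  qed
  have column: "(\<integral>\<^sup>+x. ennreal (K x (Suc n) * s x) \<partial>M) \<le> ennreal (C * t n)" for n
    by (simp add: s_def t_def kernel_column_integral)
  have s: "s \<in> borel_measurable M" "\<And>x. x \<in> space M \<Longrightarrow> s x > 0"
    unfolding s_def using mu_pos U_pos by (measurable, auto simp: less_imp_neq[symmetric])
  have pos: "t n > 0" "\<Psi>' (Suc n) > 0" for n
    using Psi_pos[of "Suc n"] by (auto simp: t_def)
  have nonneg: "x \<in> space M \<Longrightarrow> K x (Suc n) \<ge> 0" "x \<in> space M \<Longrightarrow> \<Phi> x \<ge> 0" for x n
    using K_pos[of x "Suc n"] Phi_pos[of x] by auto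
  note S = Schur_test[OF pair_sigma_finite_axioms p C_pos nonneg(1) kernel_measurable_pair(1) s(2,1)
      pos(1) _ pos(2) _ nonneg(2) f' column row, folded I_def, simplified]
  \<comment> \<open>The counting measure has no nonempty null set, so the almost everywhere
    statement holds for each n.\<close>
  show "integrable M (\<lambda>x. K x n * f x)" if "n \<ge> 1" for n
    using S(1) that by (cases n) (auto simp: AE_count_space)
  have sum: "(\<Sum>n. ennreal (\<Psi>' (Suc n) * \<bar>T1 K f (Suc n)\<bar> powr p)) \<le> ennreal (C powr p * I)"
    using S(2) by (simp add: nn_integral_count_space_nat T1_def)
  note B = suminf_le_of_ennreal[OF _ _ sum]
  show "T1 K f \<in> lw p \<Psi>'"
    using B(1) I by (simp add: lw_def)
  have "lw_norm p \<Psi>' (T1 K f) \<le> (C powr p * I) powr (1 / p)"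
    unfolding lw_norm_def using B I p by (intro powr_mono2 suminf_nonneg) auto
  also have "\<dots> = C * Lw_norm p \<Phi> f"
    using p C_pos I by (simp add: powr_mult powr_powr Lw_norm_def I_def)
  finally show "lw_norm p \<Psi>' (T1 K f) \<le> C * Lw_norm p \<Phi> f" .
qed

text \<open>Hoelder at a fixed x with weight s = \<nu>_(n+1) w_n^(\<sigma> - 1). Here s^(1 - q) =
  w_n^\<sigma> \<Psi>, and the pointwise bound on K w_n^\<sigma> leaves a multiple of the norm sum
  of a.\<close>

lemma T2_summable:
  assumes a: "a \<in> lw q \<Psi>" and x: "x > 0"
  shows "summable (\<lambda>n. \<bar>K x (Suc n) * a (Suc n)\<bar>)"
proof -
  define s where "s n = \<nu> (Suc (Suc n)) * w (Suc n) powr (\<sigma> - 1)" for n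
  define c where "c = C * U x powr (- (\<delta> * \<sigma>))"
  have c: "c > 0" using C_pos U_pos[OF x] by (simp add: c_def)
  have sum: "summable (\<lambda>n. \<Psi> (Suc n) * \<bar>a (Suc n)\<bar> powr q)"
    using a by (simp add: lw_def)
  have pos: "\<Psi> (Suc n) * \<bar>a (Suc n)\<bar> powr q \<ge> 0" for n
    using Psi_pos[of "Suc n"] by simp
  have le: "K x (Suc n) * \<bar>a (Suc n)\<bar> powr q * s n powr (1 - q) \<le> c * (\<Psi> (Suc n) * \<bar>a (Suc n)\<bar> powr q)" for n
  proof -
    have "w (Suc n) powr ((\<sigma> - 1) * (1 - q)) = w (Suc n) powr \<sigma> * w (Suc n) powr (q * (1 - \<sigma>) - 1)"
      by (simp add: algebra_simps flip: powr_add)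
    moreover have "\<nu> (Suc (Suc n)) powr (1 - q) = inverse (\<nu> (Suc (Suc n)) powr (q - 1))"
      by (simp flip: powr_minus)
    ultimately have "s n powr (1 - q) = w (Suc n) powr \<sigma> * \<Psi> (Suc n)"
      by (simp add: s_def powr_mult powr_powr weight_Psi_def w_def[symmetric] divide_inverse)
    then have "K x (Suc n) * \<bar>a (Suc n)\<bar> powr q * s n powr (1 - q)
        = (K x (Suc n) * w (Suc n) powr \<sigma>) * (\<Psi> (Suc n) * \<bar>a (Suc n)\<bar> powr q)"
      by simp
    also have "\<dots> \<le> c * (\<Psi> (Suc n) * \<bar>a (Suc n)\<bar> powr q)"
      unfolding c_def by (intro mult_right_mono kernel_pointwise_bound x pos) auto
    finally show ?thesis .
  qed
  have "integrable (count_space UNIV) (\<lambda>n. K x (Suc n) * a (Suc n))"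
  proof (rule weighted_Hoelder(1)[OF q(1) c, of "c * (\<Sum>n. \<Psi> (Suc n) * \<bar>a (Suc n)\<bar> powr q)" _ _ s])
    show "0 \<le> c * (\<Sum>n. \<Psi> (Suc n) * \<bar>a (Suc n)\<bar> powr q)"
      using c by (intro mult_nonneg_nonneg suminf_nonneg sum pos) auto
    show "(\<integral>\<^sup>+n. ennreal (K x (Suc n) * s n) \<partial>count_space UNIV) \<le> ennreal c"
      unfolding nn_integral_count_space_nat s_def c_def by (rule kernel_row_sum[OF x])
    have "(\<integral>\<^sup>+n. ennreal (K x (Suc n) * \<bar>a (Suc n)\<bar> powr q * s n powr (1 - q)) \<partial>count_space UNIV)
        \<le> (\<integral>\<^sup>+n. ennreal (c * (\<Psi> (Suc n) * \<bar>a (Suc n)\<bar> powr q)) \<partial>count_space UNIV)"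
      by (intro nn_integral_mono ennreal_leI le)
    also have "\<dots> = ennreal (\<Sum>n. c * (\<Psi> (Suc n) * \<bar>a (Suc n)\<bar> powr q))"
      unfolding nn_integral_count_space_nat using c pos
      by (intro suminf_ennreal2 summable_mult sum) auto
    also have "\<dots> = ennreal (c * (\<Sum>n. \<Psi> (Suc n) * \<bar>a (Suc n)\<bar> powr q))"
      by (simp add: suminf_mult[OF sum])
    finally show "(\<integral>\<^sup>+n. ennreal (K x (Suc n) * \<bar>a (Suc n)\<bar> powr q * s n powr (1 - q)) \<partial>count_space UNIV)
        \<le> ennreal (c * (\<Sum>n. \<Psi> (Suc n) * \<bar>a (Suc n)\<bar> powr q))" .
  qed (use K_pos[OF x] in \<open>auto simp: s_def less_imp_le\<close>)
  then show ?thesis by (simp add: integrable_count_space_nat_iff)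
qed

lemma T2_measurable [measurable]: "T2 K a \<in> borel_measurable M"
  unfolding T2_def[abs_def] by measurable

text \<open>The marginals of T1 with their roles exchanged: now s = \<nu>_(n+1) w_n^(\<sigma> - 1)
  and t = U^(-\<delta> \<sigma>), with \<open>\<Phi>'\<close> t^(q - 1) = \<mu> U^(\<delta> \<sigma>
  - 1) and s^(q - 1) \<Psi> = w_n^(-\<sigma>).\<close>

lemma T2_bounded:
  assumes a: "a \<in> lw q \<Psi>"
  shows "T2 K a \<in> Lw q \<Phi>'" and "Lw_norm q \<Phi>' (T2 K a) \<le> C * lw_norm q \<Psi> a"
proof -
  define s where "s n = \<nu> (Suc (Suc n)) * w (Suc n) powr (\<sigma> - 1)" for n
  define t where "t x = U x powr (- (\<delta> * \<sigma>))" for x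
  define I where "I = (\<Sum>n. \<Psi> (Suc n) * \<bar>a (Suc n)\<bar> powr q)"
  have sum: "summable (\<lambda>n. \<Psi> (Suc n) * \<bar>a (Suc n)\<bar> powr q)"
    using a by (simp add: lw_def)
  have pos: "\<Psi> (Suc n) * \<bar>a (Suc n)\<bar> powr q \<ge> 0" for n
    using Psi_pos[of "Suc n"] by simp
  have I: "I \<ge> 0" unfolding I_def by (intro suminf_nonneg sum pos)
  have int: "integrable (count_space UNIV) (\<lambda>n. \<Psi> (Suc n) * \<bar>a (Suc n)\<bar> powr q)"
    using sum pos by (simp add: integrable_count_space_nat_iff)
  interpret pair_sigma_finite "count_space (UNIV :: nat set)" M
    by (intro pair_sigma_finite.intro sigma_finite_M sigma_finite_nat)
  have row: "(\<integral>\<^sup>+x. ennreal (K x (Suc n) * (\<Phi>' x * t x powr (q - 1))) \<partial>M)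
      \<le> ennreal (C * (s n powr (q - 1) * \<Psi> (Suc n)))" for n
  proof -
    have 1: "\<Phi>' x * t x powr (q - 1) = \<mu> x * U x powr (\<delta> * \<sigma> - 1)" if "x > 0" for x
    proof -
      have "U x powr (q * (\<delta> * \<sigma>) - 1) * U x powr (- (\<delta> * \<sigma>) * (q - 1)) = U x powr (\<delta> * \<sigma> - 1)"
        using U_pos[OF that] by (simp add: algebra_simps flip: powr_add)
      then show ?thesis by (simp add: Phi'_eq that t_def powr_powr)
    qed
    have 2: "s n powr (q - 1) * \<Psi> (Suc n) = w (Suc n) powr (- \<sigma>)"
    proof -
      have "w (Suc n) powr ((\<sigma> - 1) * (q - 1)) * w (Suc n) powr (q * (1 - \<sigma>) - 1) = w (Suc n) powr (- \<sigma>)"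
        by (simp add: algebra_simps flip: powr_add)
      then show ?thesis
        by (simp add: s_def weight_Psi_def powr_mult powr_powr w_def[symmetric])
    qed
    have "(\<integral>\<^sup>+x. ennreal (K x (Suc n) * (\<Phi>' x * t x powr (q - 1))) \<partial>M)
        = (\<integral>\<^sup>+x. ennreal (K x (Suc n) * (\<mu> x * U x powr (\<delta> * \<sigma> - 1))) \<partial>M)"
      by (intro nn_integral_cong) (simp add: 1)
    then show ?thesis
      unfolding 2 by (simp add: kernel_column_integral)
  qed
  have column: "(\<integral>\<^sup>+n. ennreal (K x (Suc n) * s n) \<partial>count_space UNIV) \<le> ennreal (C * t x)" if "x \<in> space M" for x
    unfolding nn_integral_count_space_nat s_def t_def using that by (intro kernel_row_sum) simp
  have t: "t \<in> borel_measurable M" "\<And>x. x \<in> space M \<Longrightarrow> t x > 0"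
    unfolding t_def using U_pos by (measurable, auto simp: less_imp_neq[symmetric])
  have weight: "\<Phi>' \<in> borel_measurable M" "\<And>x. x \<in> space M \<Longrightarrow> \<Phi>' x > 0"
    using Phi_pos by (measurable, auto simp: less_imp_neq[symmetric])
  have pos': "s n > 0" for n by (simp add: s_def)
  have nonneg: "x \<in> space M \<Longrightarrow> K x (Suc n) \<ge> 0" "\<Psi> (Suc n) \<ge> 0" for x n
    using K_pos[of x "Suc n"] Psi_pos[of "Suc n"] by auto
  have "(\<integral>\<^sup>+x. ennreal (\<Phi>' x * \<bar>\<integral>n. K x (Suc n) * a (Suc n) \<partial>count_space UNIV\<bar> powr q) \<partial>M) \<le>
      ennreal (C powr q * (\<integral>n. \<Psi> (Suc n) * \<bar>a (Suc n)\<bar> powr q \<partial>count_space UNIV))"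
    by (rule Schur_test(2)[OF pair_sigma_finite_axioms q(1) C_pos nonneg(1) kernel_measurable_pair(2) pos' _
      t(2,1) weight(2,1) nonneg(2) _ int column row]) simp_all
  \<comment> \<open>An integral over the counting measure equals the sum defining T2 only under
    absolute convergence, which is available at every x > 0.\<close>
  also have "(\<integral>\<^sup>+x. ennreal (\<Phi>' x * \<bar>\<integral>n. K x (Suc n) * a (Suc n) \<partial>count_space UNIV\<bar> powr q) \<partial>M)
      = (\<integral>\<^sup>+x. ennreal (\<Phi>' x * \<bar>T2 K a x\<bar> powr q) \<partial>M)"
    using T2_summable[OF a]
    by (intro nn_integral_cong) (simp add: T2_def integral_count_space_nat integrable_count_space_nat_iff)
  also have "(\<integral>n. \<Psi> (Suc n) * \<bar>a (Suc n)\<bar> powr q \<partial>count_space UNIV) = I"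
    unfolding I_def by (rule integral_count_space_nat[OF int])
  finally have le: "(\<integral>\<^sup>+x. ennreal (\<Phi>' x * \<bar>T2 K a x\<bar> powr q) \<partial>M) \<le> ennreal (C powr q * I)" .
  have int': "integrable M (\<lambda>x. \<Phi>' x * \<bar>T2 K a x\<bar> powr q)"
    using le by (intro integrableI_bounded) (auto intro: le_less_trans simp: abs_mult)
  then show "T2 K a \<in> Lw q \<Phi>'"
    by (simp add: Lw_def)
  have "ennreal (\<integral>x. \<Phi>' x * \<bar>T2 K a x\<bar> powr q \<partial>M) \<le> ennreal (C powr q * I)"
    using le int' by (subst nn_integral_eq_integral[symmetric]) auto
  then have "(\<integral>x. \<Phi>' x * \<bar>T2 K a x\<bar> powr q \<partial>M) \<le> C powr q * I"
    using I by (subst (asm) ennreal_le_iff) auto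
  then have "Lw_norm q \<Phi>' (T2 K a) \<le> (C powr q * I) powr (1 / q)"
    unfolding Lw_norm_def using q(1) by (intro powr_mono2 Bochner_Integration.integral_nonneg) auto
  also have "\<dots> = C * lw_norm q \<Psi> a"
    using q(1) C_pos I by (simp add: powr_mult powr_powr lw_norm_def I_def)
  finally show "Lw_norm q \<Phi>' (T2 K a) \<le> C * lw_norm q \<Psi> a" .
qed

end

subsection \<open>Sharpness of the constant\<close>

text \<open>Only growth rates survive as X tends to infinity. It is applied with X the logarithm of
  w_N, where c and d carry the constants from m and r.\<close>

lemma le_of_eventually_affine_le:
  fixes A B c d :: real and X :: "nat \<Rightarrow> real"
  assumes X: "filterlim X at_top sequentially"
    and ev: "eventually (\<lambda>N. A * (X N - c) \<le> B * (X N - d)) sequentially"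
  shows "A \<le> B"
proof (rule ccontr)
  assume "\<not> A \<le> B"
  then have AB: "A - B > 0" by simp
  have "eventually (\<lambda>N. X N > (A * c - B * d) / (A - B)) sequentially"
    using X by (simp add: filterlim_at_top_dense)
  with ev have "eventually (\<lambda>N. False) sequentially"
  proof eventually_elim
    case (elim N)
    then show ?case using AB by (simp add: field_simps)
  qed
  then show False by simp
qed

context csch_setting
begin

lemma abs_w_Suc [simp]: "\<bar>w (Suc n)\<bar> = w (Suc n)" and abs_nu_Suc [simp]: "\<bar>\<nu> (Suc n)\<bar> = \<nu> (Suc n)"
  by (rule abs_of_pos, rule w_Suc_pos nu_Suc_pos)+

definition truncated_integral :: "real \<Rightarrow> real \<Rightarrow> real" where
  "truncated_integral r R = (\<integral>t. \<phi> t * indicator {r..R} t \<partial>M)"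

definition extremal_fun :: "real \<Rightarrow> real \<Rightarrow> real" where
  "extremal_fun a x = \<mu> x * U x powr (\<delta> * \<sigma> - 1) * indicator {a..1} (U x powr \<delta>)"

text \<open>A left Riemann sum of du / u along the points w_n, since \<nu>_(n+1) = w_(n+1) -
  w_n.\<close>

definition log_sum :: "nat \<Rightarrow> nat \<Rightarrow> real" where
  "log_sum m N = (\<Sum>i=m..<N. \<nu> (Suc (Suc i)) / w (Suc i))"

lemma phi_indicator_integrable:
  assumes [measurable]: "A \<in> sets borel"
  shows "integrable M (\<lambda>t. \<phi> t * indicator A (t / c))"
proof (rule Bochner_Integration.integrable_bound[OF phi_integrable])
  have "(\<lambda>t. \<phi> t * indicator A (t / c)) \<in> borel_measurable borel" by measurable
  then show "(\<lambda>t. \<phi> t * indicator A (t / c)) \<in> borel_measurable M"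
    by (simp add: measurable_completion measurable_restrict_space1)
qed (auto split: split_indicator)

lemma truncated_integral_nonneg: "r > 0 \<Longrightarrow> truncated_integral r R \<ge> 0"
  unfolding truncated_integral_def
  by (intro Bochner_Integration.integral_nonneg) (auto intro!: mult_nonneg_nonneg less_imp_le[OF phi_pos])

lemma truncated_integral_tendsto:
  "(\<lambda>j. truncated_integral (1 / real (Suc j)) (real (Suc j))) \<longlonglongrightarrow> C"
  unfolding truncated_integral_def phi_integral[symmetric]
proof (rule integral_dominated_convergence[where w = \<phi>])
  show "AE t in M. (\<lambda>j. \<phi> t * indicator {1 / real (Suc j)..real (Suc j)} t) \<longlonglongrightarrow> \<phi> t"
  proof (rule AE_I2)
    fix t assume "t \<in> space M"
    then have t: "t > 0" by simp
    have "filterlim (\<lambda>j. real (Suc j)) at_top sequentially"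
      by (rule filterlim_compose[OF filterlim_real_sequentially filterlim_Suc])
    then have "eventually (\<lambda>j. real (Suc j) \<ge> max t (1 / t)) sequentially"
      unfolding filterlim_at_top by (rule spec)
    then have "eventually (\<lambda>j. \<phi> t * indicator {1 / real (Suc j)..real (Suc j)} t = \<phi> t) sequentially"
    proof eventually_elim
      case (elim j)
      then show ?case using t by (simp add: field_simps split: split_indicator)
    qed
    then show "(\<lambda>j. \<phi> t * indicator {1 / real (Suc j)..real (Suc j)} t) \<longlonglongrightarrow> \<phi> t"
      by (rule tendsto_eventually)
  qed
  show "(\<lambda>t. \<phi> t * indicator {1 / real (Suc j)..real (Suc j)} t) \<in> borel_measurable M" for j
    using phi_indicator_integrable[of "{1 / real (Suc j)..real (Suc j)}" 1] by auto
  show "AE t in M. norm (\<phi> t * indicator {1 / real (Suc j)..real (Suc j)} t) \<le> \<phi> t" for j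
    using phi_pos by (intro AE_I2) (auto split: split_indicator simp: less_imp_le)
qed (use phi_integrable in auto)

text \<open>In the variable y = U^\<delta> the measure \<Phi> |f|^p dx becomes dy / y on [a, 1],
  independently of p, \<sigma> and \<delta>. The last claim admits the function to the supremum that
  defines the norm.\<close>

lemma extremal_fun_Phi:
  assumes a: "0 < a" "a < 1"
  shows "extremal_fun a \<in> Lw p \<Phi>" and "(\<integral>x. \<Phi> x * \<bar>extremal_fun a x\<bar> powr p \<partial>M) = - ln a"
    and "\<not> (AE x in M. extremal_fun a x = 0)"
proof -
  define h where "h t = (if t \<in> {a..1} then 1 / t else 0)" for t :: real
  have "((\<lambda>t. 1 / t) has_integral (ln 1 - ln a)) {a..1}"
    using a
    by (intro fundamental_theorem_of_calculus)
      (auto intro!: derivative_eq_intros simp flip: has_real_derivative_iff_has_vector_derivative)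
  then have "(h has_integral (- ln a)) {0<..}"
    unfolding h_def using a by (subst has_integral_restrict) auto
  from integrable_lebesgue_on_has_integral[OF _ _ this]
  have h: "integrable M h" "(\<integral>t. h t \<partial>M) = - ln a" by (auto simp: h_def)
  note sub = U_powr_substitution[OF delta zero_less_one h(1)]
  have eq: "\<Phi> x * \<bar>extremal_fun a x\<bar> powr p = 1 * U x powr (\<delta> - 1) * \<mu> x * h (U x powr \<delta> * 1)"
    if "x \<in> space M" for x
  proof (cases "U x powr \<delta> \<in> {a..1}")
    case True
    have x: "x > 0" using that by simp
    note pos = U_pos[OF x] mu_pos[OF x]
    have "\<Phi> x * \<bar>extremal_fun a x\<bar> powr p
        = (U x powr (p * (1 - \<delta> * \<sigma>) - 1) * U x powr ((\<delta> * \<sigma> - 1) * p)) * (\<mu> x powr p / \<mu> x powr (p - 1))"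
      using True pos by (simp add: extremal_fun_def weight_Phi_def powr_mult powr_powr)
    also have "\<mu> x powr p / \<mu> x powr (p - 1) = \<mu> x"
      using pos by (simp flip: powr_diff)
    also have "U x powr (p * (1 - \<delta> * \<sigma>) - 1) * U x powr ((\<delta> * \<sigma> - 1) * p) = U x powr - 1"
      by (simp only: powr_add[symmetric]) (simp add: algebra_simps)
    also have "U x powr - 1 = U x powr (\<delta> - 1) * (1 / U x powr \<delta>)"
      using pos by (simp add: powr_diff powr_minus divide_inverse)
    finally show ?thesis using True by (simp add: h_def)
  next
    case False
    then show ?thesis using p by (auto simp: extremal_fun_def h_def)
  qed
  have meas [measurable]: "extremal_fun a \<in> borel_measurable M"
    unfolding extremal_fun_def by measurable
  have "integrable M (\<lambda>x. \<Phi> x * \<bar>extremal_fun a x\<bar> powr p)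
      \<longleftrightarrow> integrable M (\<lambda>x. 1 * U x powr (\<delta> - 1) * \<mu> x * h (U x powr \<delta> * 1))"
    by (intro Bochner_Integration.integrable_cong refl eq)
  then show "extremal_fun a \<in> Lw p \<Phi>"
    using sub(1) by (simp add: Lw_def)
  have "(\<integral>x. \<Phi> x * \<bar>extremal_fun a x\<bar> powr p \<partial>M) = (\<integral>x. 1 * U x powr (\<delta> - 1) * \<mu> x * h (U x powr \<delta> * 1) \<partial>M)"
    by (intro Bochner_Integration.integral_cong refl eq)
  then show val: "(\<integral>x. \<Phi> x * \<bar>extremal_fun a x\<bar> powr p \<partial>M) = - ln a"
    unfolding sub(2) h(2) .
  show "\<not> (AE x in M. extremal_fun a x = 0)"
  proof
    assume "AE x in M. extremal_fun a x = 0"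
    then have "(\<integral>x. \<Phi> x * \<bar>extremal_fun a x\<bar> powr p \<partial>M) = 0"
      using p by (intro integral_eq_zero_AE) (auto elim!: eventually_mono)
    then show False using val a by simp
  qed
qed

text \<open>The indicator of [a, 1] at t / w_n restricts t to [a w_n, w_n], which contains [r, R]
  under the two conditions.\<close>

lemma T1_extremal_fun_ge:
  assumes n: "n \<ge> 1" and r: "r > 0" and a: "a * w n \<le> r" and R: "R \<le> w n"
  shows "truncated_integral r R * w n powr (- \<sigma>) \<le> T1 K (extremal_fun a) n"
proof -
  have int: "integrable M (\<lambda>t. \<phi> t * indicator {a..1} (t / w n))"
    by (rule phi_indicator_integrable) auto
  have "truncated_integral r R \<le> (\<integral>t. \<phi> t * indicator {a..1} (t / w n) \<partial>M)"
    unfolding truncated_integral_def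
  proof (rule integral_mono)
    show "integrable M (\<lambda>t. \<phi> t * indicator {r..R} t)"
      using phi_indicator_integrable[of "{r..R}" 1] by simp
    fix t assume "t \<in> space M"
    then have t: "t > 0" by simp
    show "\<phi> t * indicator {r..R} t \<le> \<phi> t * indicator {a..1} (t / w n)"
      using phi_pos[OF t] w_pos[OF n] a R
      by (intro mult_left_mono) (auto split: split_indicator simp: field_simps)
  qed (rule int)
  then have "w n powr (- \<sigma>) * truncated_integral r R \<le> w n powr (- \<sigma>) * (\<integral>t. \<phi> t * indicator {a..1} (t / w n) \<partial>M)"
    by (intro mult_left_mono) auto
  also have "\<dots> = T1 K (extremal_fun a) n"
    unfolding T1_def extremal_fun_def by (rule kernel_column_substitution(2)[OF n int, symmetric])
  finally show ?thesis by (simp add: mult.commute)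
qed

lemma w_powr_inverse: "a + b = - 1 \<Longrightarrow> w (Suc i) powr a * w (Suc i) powr b = 1 / w (Suc i)"
  by (simp add: powr_neg_one flip: powr_add)

text \<open>Telescoping, because \<nu>_(n+1) / w_n = w_(n+1) / w_n - 1 >= ln (w_(n+1) /
  w_n).\<close>

lemma log_sum_ge: "m \<le> N \<Longrightarrow> ln (w (Suc N)) - ln (w (Suc m)) \<le> log_sum m N"
proof (induction N rule: dec_induct)
  case (step N)
  have "ln (w (Suc (Suc N))) - ln (w (Suc N)) = ln (1 + \<nu> (Suc (Suc N)) / w (Suc N))"
  proof -
    have "1 + \<nu> (Suc (Suc N)) / w (Suc N) = w (Suc (Suc N)) / w (Suc N)"
      by (simp add: w_Suc[of "Suc N"] add_divide_distrib)
    then show ?thesis by (simp add: ln_div)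
  qed
  also have "\<dots> \<le> \<nu> (Suc (Suc N)) / w (Suc N)"
    by (intro ln_add_one_self_le_self) (auto simp: less_imp_le)
  finally show ?case using step by (simp add: log_sum_def)
qed (simp add: log_sum_def)

lemma log_sum_pos: "m < N \<Longrightarrow> log_sum m N > 0"
  unfolding log_sum_def by (intro sum_pos) auto

text \<open>The limit argument shared by T1 and T2. H is what a norm bound L yields at the extremal
  function. For fixed r and R, letting N grow gives \<kappa> <= L for the truncated integral
  \<kappa>; afterwards r tends to 0 and R to infinity.\<close>

lemma C_le_of_extremal:
  assumes L: "L \<ge> 0"
    and H: "\<And>m N a \<kappa>. m < N \<Longrightarrow> 0 < a \<Longrightarrow> a < 1 \<Longrightarrow> \<kappa> \<ge> 0 \<Longrightarrow>
      (\<And>i. m \<le> i \<Longrightarrow> i < N \<Longrightarrow> \<kappa> * w (Suc i) powr (- \<sigma>) \<le> T1 K (extremal_fun a) (Suc i)) \<Longrightarrow>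
      \<kappa> powr p * log_sum m N \<le> L powr p * (- ln a)"
  shows "C \<le> L"
proof (rule LIMSEQ_le_const2[OF truncated_integral_tendsto], intro exI[of _ 0] allI impI)
  fix j :: nat
  define r R where "r = 1 / real (Suc j)" and "R = real (Suc j)"
  define \<kappa> where "\<kappa> = truncated_integral r R"
  have r: "r > 0" by (simp add: r_def)
  have \<kappa>: "\<kappa> \<ge> 0" unfolding \<kappa>_def by (rule truncated_integral_nonneg[OF r])
  have w_Suc_top: "filterlim (\<lambda>N. w (Suc N)) at_top sequentially"
    by (rule filterlim_compose[OF w_at_top filterlim_Suc])
  then have "eventually (\<lambda>i. R \<le> w (Suc i)) sequentially"
    by (simp add: filterlim_at_top)
  \<comment> \<open>m depends on R alone and stays fixed while N grows.\<close>
  then obtain m where m: "\<And>i. i \<ge> m \<Longrightarrow> R \<le> w (Suc i)"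
    by (auto simp: eventually_sequentially)
  have "eventually (\<lambda>N. w (Suc N) > r) sequentially"
    using w_Suc_top by (simp add: filterlim_at_top_dense)
  moreover have "eventually (\<lambda>N. N > m) sequentially"
    by (rule eventually_gt_at_top)
  ultimately have "eventually (\<lambda>N. \<kappa> powr p * (ln (w (Suc N)) - ln (w (Suc m)))
      \<le> L powr p * (ln (w (Suc N)) - ln r)) sequentially"
  proof eventually_elim
    case (elim N)
    \<comment> \<open>This makes a w_(i+1) <= r for all i < N, while - ln a differs from the
      logarithm of \<open>w (Suc N)\<close> only by the constant ln r.\<close>
    define a where "a = r / w (Suc N)"
    have a: "0 < a" "a < 1" using r elim(1) by (auto simp: a_def)
    have "\<kappa> powr p * (ln (w (Suc N)) - ln (w (Suc m))) \<le> \<kappa> powr p * log_sum m N"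
      using elim(2) by (intro mult_left_mono log_sum_ge) auto
    also have "\<dots> \<le> L powr p * (- ln a)"
    proof (rule H[OF elim(2) a \<kappa>])
      fix i assume i: "m \<le> i" "i < N"
      have "r * w (Suc i) \<le> r * w (Suc N)"
        using i r by (intro mult_left_mono w_mono) auto
      then have "a * w (Suc i) \<le> r"
        by (simp add: a_def pos_divide_le_eq)
      then show "\<kappa> * w (Suc i) powr (- \<sigma>) \<le> T1 K (extremal_fun a) (Suc i)"
        unfolding \<kappa>_def using i r m by (intro T1_extremal_fun_ge) auto
    qed
    also have "- ln a = ln (w (Suc N)) - ln r"
      using r by (simp add: a_def ln_div)
    finally show ?case .
  qed
  from le_of_eventually_affine_le[OF _ this] have "\<kappa> powr p \<le> L powr p"
    by (simp add: filterlim_compose[OF ln_at_top w_Suc_top])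
  then have "\<kappa> \<le> L"
    using p \<kappa> L powr_less_mono2[of p L \<kappa>] by (meson less_le_trans not_le order.strict_trans zero_less_one)
  then show "truncated_integral (1 / real (Suc j)) (real (Suc j)) \<le> L"
    by (simp add: \<kappa>_def r_def R_def)
qed

text \<open>Only the terms m <= i < N of the norm of T1 f are kept. Each is at least \<kappa>^p
  times \<open>\<Psi>'\<close> w_n^(-p \<sigma>) = \<nu>_(n+1) / w_n, with n = i + 1.\<close>

lemma T1_norm_ge:
  assumes L: "L \<ge> 0"
    and bound: "\<And>f. f \<in> Lw p \<Phi> \<Longrightarrow> \<not> (AE x in M. f x = 0) \<Longrightarrow> lw_norm p \<Psi>' (T1 K f) \<le> L * Lw_norm p \<Phi> f"
  shows "C \<le> L"
proof (rule C_le_of_extremal[OF L])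
  fix m N :: nat and a \<kappa> :: real
  assume mN: "m < N" and a: "0 < a" "a < 1" and \<kappa>: "\<kappa> \<ge> 0"
    and ge: "\<And>i. m \<le> i \<Longrightarrow> i < N \<Longrightarrow> \<kappa> * w (Suc i) powr (- \<sigma>) \<le> T1 K (extremal_fun a) (Suc i)"
  let ?f = "extremal_fun a"
  define g where "g i = \<Psi>' (Suc i) * \<bar>T1 K ?f (Suc i)\<bar> powr p" for i
  note ex = extremal_fun_Phi[OF a]
  have g: "summable g" "\<And>i. g i \<ge> 0"
    using T1_bounded(2)[OF ex(1)] by (auto simp: lw_def g_def[abs_def])
  have "\<kappa> powr p * log_sum m N = (\<Sum>i=m..<N. \<kappa> powr p * (\<nu> (Suc (Suc i)) / w (Suc i)))"
    by (simp add: log_sum_def sum_distrib_left)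
  also have "\<dots> \<le> (\<Sum>i=m..<N. g i)"
  proof (rule sum_mono)
    fix i assume "i \<in> {m..<N}"
    then have "(\<kappa> * w (Suc i) powr (- \<sigma>)) powr p \<le> \<bar>T1 K ?f (Suc i)\<bar> powr p"
      using ge[of i] p \<kappa> by (intro powr_mono2) auto
    then have "\<Psi>' (Suc i) * (\<kappa> * w (Suc i) powr (- \<sigma>)) powr p \<le> g i"
      unfolding g_def by (intro mult_left_mono) auto
    also have "\<Psi>' (Suc i) * (\<kappa> * w (Suc i) powr (- \<sigma>)) powr p
        = \<kappa> powr p * \<nu> (Suc (Suc i)) * (w (Suc i) powr (p * \<sigma> - 1) * w (Suc i) powr - (\<sigma> * p))"
      using \<kappa> by (simp add: Psi'_eq powr_mult powr_powr)
    also have "w (Suc i) powr (p * \<sigma> - 1) * w (Suc i) powr - (\<sigma> * p) = 1 / w (Suc i)"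
      by (rule w_powr_inverse) (simp add: algebra_simps)
    also have "\<kappa> powr p * \<nu> (Suc (Suc i)) * (1 / w (Suc i)) = \<kappa> powr p * (\<nu> (Suc (Suc i)) / w (Suc i))"
      by simp
    finally show "\<kappa> powr p * (\<nu> (Suc (Suc i)) / w (Suc i)) \<le> g i" .
  qed
  also have "\<dots> \<le> suminf g"
    using g by (intro sum_le_suminf) auto
  also have "\<dots> = lw_norm p \<Psi>' (T1 K ?f) powr p"
    using p suminf_nonneg[OF g] unfolding g_def by (simp add: lw_norm_def powr_powr)
  also have "\<dots> \<le> (L * Lw_norm p \<Phi> ?f) powr p"
    using p by (intro powr_mono2 bound ex) (auto simp: lw_norm_def)
  also have "\<dots> = L powr p * (- ln a)"
    using p L a by (simp add: powr_mult Lw_norm_def ex(2) powr_powr)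
  finally show "\<kappa> powr p * log_sum m N \<le> L powr p * (- ln a)" .
qed

text \<open>The integral of (T2 b) f is the sum of b_n (T1 f)_n, so the lower bounds for T1 f apply
  to it, while Hoelder bounds it above through the norm of T2 b. L is strictly positive because the
  Hoelder lemma is used with the positive constant L^q S.\<close>

lemma T2_norm_ge:
  assumes L: "L > 0"
    and bound: "\<And>b. b \<in> lw q \<Psi> \<Longrightarrow> \<not> (\<forall>n\<ge>1. b n = 0) \<Longrightarrow> Lw_norm q \<Phi>' (T2 K b) \<le> L * lw_norm q \<Psi> b"
  shows "C \<le> L"
proof (rule C_le_of_extremal[OF less_imp_le[OF L]])
  fix m N :: nat and a \<kappa> :: real
  assume mN: "m < N" and a: "0 < a" "a < 1" and \<kappa>: "\<kappa> \<ge> 0"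
    and ge: "\<And>i. m \<le> i \<Longrightarrow> i < N \<Longrightarrow> \<kappa> * w (Suc i) powr (- \<sigma>) \<le> T1 K (extremal_fun a) (Suc i)"
  let ?f = "extremal_fun a"
  note ex = extremal_fun_Phi[OF a]
  define S where "S = log_sum m N"
  have S: "S > 0" unfolding S_def by (rule log_sum_pos[OF mN])
  \<comment> \<open>The discrete Schur weight cut to finitely many indices: its q-th norm power is
    exactly S, and T2 b becomes a finite sum.\<close>
  define b where "b n = (if n \<in> {Suc m..N} then \<nu> (Suc n) * w n powr (\<sigma> - 1) else 0)" for n
  have b_in: "b (Suc i) = \<nu> (Suc (Suc i)) * w (Suc i) powr (\<sigma> - 1)" if "i \<in> {m..<N}" for i
    using that by (simp add: b_def)
  have b_out: "b (Suc i) = 0" if "i \<notin> {m..<N}" for i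
    using that by (auto simp: b_def)
  have b_pow: "\<Psi> (Suc i) * \<bar>b (Suc i)\<bar> powr q = \<nu> (Suc (Suc i)) / w (Suc i)" if "i \<in> {m..<N}" for i
  proof -
    have "w (Suc i) powr (q * (1 - \<sigma>) - 1) * w (Suc i) powr ((\<sigma> - 1) * q) = 1 / w (Suc i)"
      by (rule w_powr_inverse) (simp add: algebra_simps)
    moreover have "\<nu> (Suc (Suc i)) powr q / \<nu> (Suc (Suc i)) powr (q - 1) = \<nu> (Suc (Suc i))"
      by (simp flip: powr_diff)
    moreover have "\<Psi> (Suc i) * \<bar>b (Suc i)\<bar> powr q
        = (\<nu> (Suc (Suc i)) powr q / \<nu> (Suc (Suc i)) powr (q - 1))
          * (w (Suc i) powr (q * (1 - \<sigma>) - 1) * w (Suc i) powr ((\<sigma> - 1) * q))"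
      by (simp add: weight_Psi_def b_in[OF that] powr_mult powr_powr abs_mult w_def[symmetric])
    ultimately show ?thesis by simp
  qed
  have b_lw: "b \<in> lw q \<Psi>"
    unfolding lw_def using b_out by (auto intro!: summable_finite[of "{m..<N}"])
  have "(\<Sum>i. \<Psi> (Suc i) * \<bar>b (Suc i)\<bar> powr q) = (\<Sum>i=m..<N. \<Psi> (Suc i) * \<bar>b (Suc i)\<bar> powr q)"
    using b_out by (intro suminf_finite) auto
  also have "\<dots> = S"
    unfolding S_def log_sum_def by (intro sum.cong refl b_pow)
  finally have b_norm: "lw_norm q \<Psi> b = S powr (1 / q)"
    by (simp add: lw_norm_def)
  have b_nz: "\<not> (\<forall>n\<ge>1. b n = 0)"
    using mN b_in[of m] by (auto intro!: exI[of _ "Suc m"])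
  have T2_eq: "T2 K b x = (\<Sum>i=m..<N. K x (Suc i) * b (Suc i))" for x
    unfolding T2_def using b_out by (intro suminf_finite) auto
  have T2_pos: "T2 K b x > 0" if "x > 0" for x
    unfolding T2_eq using mN K_pos[OF that] b_in by (intro sum_pos) auto
  define c where "c = L powr q * S"
  have c: "c > 0" using L S by (simp add: c_def)
  define J where "J = - ln a"
  have J: "J > 0" using a by (simp add: J_def)
  \<comment> \<open>Chosen so that (T2 b) s = \<open>\<Phi>'\<close> |T2 b|^q and (T2 b) s^(1 - p) =
    \<Phi>, by (q - 1)(1 - p) = -1. The weighted lemma thereby becomes Hoelder's inequality for the
    dual pair of weights.\<close>
  define s where "s x = \<Phi>' x * T2 K b x powr (q - 1)" for x
  have T2_Lw: "integrable M (\<lambda>x. \<Phi>' x * \<bar>T2 K b x\<bar> powr q)"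
    using T2_bounded(1)[OF b_lw] by (simp add: Lw_def)
  have "(\<integral>x. T2 K b x * ?f x \<partial>M) = (\<integral>x. (\<Sum>i=m..<N. b (Suc i) * (K x (Suc i) * ?f x)) \<partial>M)"
    unfolding T2_eq sum_distrib_right
    by (intro Bochner_Integration.integral_cong sum.cong refl) (simp only: mult_ac)
  also have "\<dots> = (\<Sum>i=m..<N. \<integral>x. b (Suc i) * (K x (Suc i) * ?f x) \<partial>M)"
    by (intro Bochner_Integration.integral_sum integrable_mult_right T1_bounded(1)[OF ex(1)]) simp
  also have "\<dots> = (\<Sum>i=m..<N. b (Suc i) * T1 K ?f (Suc i))"
    by (simp add: T1_def)
  finally have pairing: "(\<integral>x. T2 K b x * ?f x \<partial>M) = (\<Sum>i=m..<N. b (Suc i) * T1 K ?f (Suc i))" .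
  have "\<kappa> * S = (\<Sum>i=m..<N. b (Suc i) * (\<kappa> * w (Suc i) powr (- \<sigma>)))"
    unfolding S_def log_sum_def sum_distrib_left
  proof (rule sum.cong[OF refl])
    fix i assume i: "i \<in> {m..<N}"
    have "b (Suc i) * (\<kappa> * w (Suc i) powr (- \<sigma>))
        = \<kappa> * \<nu> (Suc (Suc i)) * (w (Suc i) powr (\<sigma> - 1) * w (Suc i) powr (- \<sigma>))"
      by (simp add: b_in[OF i])
    also have "w (Suc i) powr (\<sigma> - 1) * w (Suc i) powr (- \<sigma>) = 1 / w (Suc i)"
      by (rule w_powr_inverse) simp
    finally show "\<kappa> * (\<nu> (Suc (Suc i)) / w (Suc i)) = b (Suc i) * (\<kappa> * w (Suc i) powr (- \<sigma>))"
      by simp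
  qed
  also have "\<dots> \<le> (\<Sum>i=m..<N. b (Suc i) * T1 K ?f (Suc i))"
    using ge b_in by (intro sum_mono mult_left_mono) (auto simp: less_imp_le)
  finally have lower: "\<kappa> * S \<le> (\<integral>x. T2 K b x * ?f x \<partial>M)"
    unfolding pairing .
  have "(\<integral>x. \<Phi>' x * \<bar>T2 K b x\<bar> powr q \<partial>M) = Lw_norm q \<Phi>' (T2 K b) powr q"
    using q(1) by (simp add: Lw_norm_def powr_powr)
  also have "\<dots> \<le> (L * lw_norm q \<Psi> b) powr q"
    using q(1) by (intro powr_mono2 bound b_lw b_nz) (auto simp: Lw_norm_def)
  also have "\<dots> = c"
    using L S q(1) by (simp add: powr_mult b_norm powr_powr c_def)
  finally have T2_le: "(\<integral>x. \<Phi>' x * \<bar>T2 K b x\<bar> powr q \<partial>M) \<le> c" .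
  have upper: "\<bar>\<integral>x. T2 K b x * ?f x \<partial>M\<bar> powr p \<le> c powr (p - 1) * J"
  proof (rule weighted_Hoelder(2)[OF p c, of J _ _ s])
    have "(\<integral>\<^sup>+x. ennreal (T2 K b x * s x) \<partial>M) = (\<integral>\<^sup>+x. ennreal (\<Phi>' x * \<bar>T2 K b x\<bar> powr q) \<partial>M)"
    proof (rule nn_integral_cong)
      fix x assume "x \<in> space M"
      then show "ennreal (T2 K b x * s x) = ennreal (\<Phi>' x * \<bar>T2 K b x\<bar> powr q)"
        using T2_pos[of x] by (simp add: s_def powr_diff)
    qed
    also have "\<dots> = ennreal (\<integral>x. \<Phi>' x * \<bar>T2 K b x\<bar> powr q \<partial>M)"
      using T2_Lw by (intro nn_integral_eq_integral) auto
    also have "\<dots> \<le> ennreal c"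
      by (rule ennreal_leI[OF T2_le])
    finally show "(\<integral>\<^sup>+x. ennreal (T2 K b x * s x) \<partial>M) \<le> ennreal c" .
    have "(\<integral>\<^sup>+x. ennreal (T2 K b x * \<bar>?f x\<bar> powr p * s x powr (1 - p)) \<partial>M)
        = (\<integral>\<^sup>+x. ennreal (\<Phi> x * \<bar>?f x\<bar> powr p) \<partial>M)"
    proof (rule nn_integral_cong)
      fix x assume "x \<in> space M"
      then have x: "x > 0" by simp
      have e: "(1 - q) * (1 - p) = 1" "(q - 1) * (1 - p) = - 1"
        using pq(1) by (auto simp: algebra_simps)
      have "s x powr (1 - p) = \<Phi> x * inverse (T2 K b x)"
        using T2_pos[OF x] Phi_pos[OF x]
        by (simp add: s_def powr_mult powr_powr e powr_minus)
      then have "T2 K b x * s x powr (1 - p) = \<Phi> x"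
        using T2_pos[OF x] by simp
      then have "(T2 K b x * s x powr (1 - p)) * \<bar>?f x\<bar> powr p = \<Phi> x * \<bar>?f x\<bar> powr p"
        by (rule arg_cong)
      then show "ennreal (T2 K b x * \<bar>?f x\<bar> powr p * s x powr (1 - p)) = ennreal (\<Phi> x * \<bar>?f x\<bar> powr p)"
        by (simp only: mult_ac)
    qed
    also have "\<dots> = ennreal J"
      unfolding J_def ex(2)[symmetric] using ex(1) Phi_pos
      by (intro nn_integral_eq_integral) (auto simp: Lw_def less_imp_le)
    finally show "(\<integral>\<^sup>+x. ennreal (T2 K b x * \<bar>?f x\<bar> powr p * s x powr (1 - p)) \<partial>M) \<le> ennreal J"
      by simp
    show "s \<in> borel_measurable M" unfolding s_def by measurable
    show "?f \<in> borel_measurable M" using ex(1) by (simp add: Lw_def)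
    show "T2 K b \<in> borel_measurable M" by (rule T2_measurable)
    show "J \<ge> 0" using J by (rule less_imp_le)
    fix x assume "x \<in> space M"
    then have x: "x > 0" by simp
    show "T2 K b x \<ge> 0" using T2_pos[OF x] by (rule less_imp_le)
    show "s x > 0" using T2_pos[OF x] Phi_pos[OF x] by (simp add: s_def)
  qed
  have "(\<kappa> * S) powr p \<le> \<bar>\<integral>x. T2 K b x * ?f x \<partial>M\<bar> powr p"
    using p \<kappa> S lower by (intro powr_mono2) auto
  \<comment> \<open>Here q (p - 1) = p turns (L^q S)^(p - 1) into L^p S^(p - 1), and the power of S
    cancels afterwards.\<close>
  also have "\<dots> \<le> S powr (p - 1) * (L powr p * J)"
    using upper L S by (simp add: c_def powr_mult powr_powr pq(2) mult_ac)
  finally have "S powr (p - 1) * (\<kappa> powr p * S) \<le> S powr (p - 1) * (L powr p * J)"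
    using \<kappa> S by (simp add: powr_mult powr_diff mult.commute)
  then show "\<kappa> powr p * log_sum m N \<le> L powr p * (- ln a)"
    using S by (subst (asm) mult_le_cancel_left_pos) (simp_all add: S_def J_def)
qed

section \<open>Operator norms as suprema, and the theorem\<close>

lemma T1_norm_eq:
  "(SUP f \<in> {f \<in> Lw p \<Phi>. \<not> (AE x in M. f x = 0)}. lw_norm p \<Psi>' (T1 K f) / Lw_norm p \<Phi> f) = C"
  (is "(SUP f \<in> ?S. ?r f) = C")
proof (rule antisym)
  have r: "?r f \<le> C" if "f \<in> ?S" for f
    using T1_bounded(3)[of f] that C_pos by (auto simp: divide_le_eq Lw_norm_def)
  have ne: "extremal_fun (1 / 2) \<in> ?S"
    using extremal_fun_Phi[of "1 / 2"] by auto
  show "(SUP f \<in> ?S. ?r f) \<le> C"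
    using ne r by (intro cSUP_least) auto
  have bdd: "bdd_above (?r ` ?S)"
    using r by (intro bdd_aboveI2) auto
  have r_le: "?r f \<le> (SUP f \<in> ?S. ?r f)" if "f \<in> ?S" for f
    by (rule cSUP_upper[OF that bdd])
  show "C \<le> (SUP f \<in> ?S. ?r f)"
  proof (rule T1_norm_ge)
    have "0 \<le> ?r (extremal_fun (1 / 2))"
      by (simp add: lw_norm_def Lw_norm_def)
    then show "0 \<le> (SUP f \<in> ?S. ?r f)"
      using r_le[OF ne] by linarith
    fix f assume f: "f \<in> Lw p \<Phi>" "\<not> (AE x in M. f x = 0)"
    then have "?r f \<le> (SUP f \<in> ?S. ?r f)" by (intro r_le) auto
    \<comment> \<open>A vanishing norm makes the quotient 0 by convention; the upper bound for T1 f
      then gives the inequality directly.\<close>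
    then show "lw_norm p \<Psi>' (T1 K f) \<le> (SUP f \<in> ?S. ?r f) * Lw_norm p \<Phi> f"
      using T1_bounded(3)[OF f(1)]
      by (cases "Lw_norm p \<Phi> f = 0") (auto simp: divide_le_eq Lw_norm_def split: if_splits)
  qed
qed

lemma T2_norm_eq:
  "(SUP a \<in> {a \<in> lw q \<Psi>. \<not> (\<forall>n\<ge>1. a n = 0)}. Lw_norm q \<Phi>' (T2 K a) / lw_norm q \<Psi> a) = C"
  (is "(SUP a \<in> ?S. ?r a) = C")
proof (rule antisym)
  have r: "?r a \<le> C" if "a \<in> ?S" for a
    using T2_bounded(2)[of a] that C_pos by (auto simp: divide_le_eq lw_norm_def)
  define e where "e n = (if n = 1 then 1 else 0 :: real)" for n :: nat
  have ne: "e \<in> ?S"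
  proof -
    have "summable (\<lambda>n. \<Psi> (Suc n) * \<bar>e (Suc n)\<bar> powr q)"
      by (rule summable_finite[of "{0}"]) (auto simp: e_def)
    then show ?thesis by (auto simp: lw_def e_def)
  qed
  show "(SUP a \<in> ?S. ?r a) \<le> C"
    using ne r by (intro cSUP_least) auto
  have bdd: "bdd_above (?r ` ?S)"
    using r by (intro bdd_aboveI2) auto
  have r_le: "?r a \<le> (SUP a \<in> ?S. ?r a)" if "a \<in> ?S" for a
    by (rule cSUP_upper[OF that bdd])
  have "0 \<le> ?r e"
    by (simp add: lw_norm_def Lw_norm_def)
  then have nonneg: "0 \<le> (SUP a \<in> ?S. ?r a)"
    using r_le[OF ne] by linarith
  show "C \<le> (SUP a \<in> ?S. ?r a)"
  \<comment> \<open>The lower bound is available for positive constants, while the supremum is so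
    far only known to be nonnegative; the margin d supplies positivity.\<close>
  proof (rule field_le_epsilon)
    fix d :: real assume d: "d > 0"
    show "C \<le> (SUP a \<in> ?S. ?r a) + d"
    proof (rule T2_norm_ge)
      show "0 < (SUP a \<in> ?S. ?r a) + d" using nonneg d by simp
      fix a assume a: "a \<in> lw q \<Psi>" "\<not> (\<forall>n\<ge>1. a n = 0)"
      then have "?r a \<le> (SUP a \<in> ?S. ?r a)" by (intro r_le) auto
      then have "?r a \<le> (SUP a \<in> ?S. ?r a) + d" using d by linarith
      then show "Lw_norm q \<Phi>' (T2 K a) \<le> ((SUP a \<in> ?S. ?r a) + d) * lw_norm q \<Psi> a"
        using T2_bounded(2)[OF a(1)]
        by (cases "lw_norm q \<Psi> a = 0") (auto simp: divide_le_eq lw_norm_def split: if_splits)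
    qed
  qed
qed

text \<open>Makes T1 an operator on classes modulo null sets rather than on representatives.\<close>

lemma T1_cong_AE:
  assumes "f \<in> Lw p \<Phi>" "g \<in> Lw p \<Phi>" "AE x in M. f x = g x"
  shows "T1 K f n = T1 K g n"
  unfolding T1_def
proof (rule integral_cong_AE)
  have [measurable]: "f \<in> borel_measurable M" "g \<in> borel_measurable M"
    using assms by (auto simp: Lw_def)
  show "(\<lambda>x. K x n * f x) \<in> borel_measurable M" "(\<lambda>x. K x n * g x) \<in> borel_measurable M"
    by measurable
qed (use assms(3) in \<open>auto elim!: eventually_mono\<close>)

end

text \<open>Integrals, infinite sums and real suprema have default values where they do not exist.
  The clauses on integrability, summability and boundedness are there to make the norm identities
  speak of genuine operators and genuine suprema.\<close>

theorem mainTheorem3: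
  fixes \<alpha> \<rho> \<gamma> \<sigma> \<beta> \<delta> p q :: real
    and \<nu> :: "nat \<Rightarrow> real" and \<mu> :: "real \<Rightarrow> real"
  assumes nu_pos: "\<And>n. n \<ge> 1 \<Longrightarrow> \<nu> n > 0"
    and nu_decreasing: "\<And>n. n \<ge> 1 \<Longrightarrow> \<nu> (n + 1) \<le> \<nu> n"
    and beta: "\<beta> \<le> \<nu> 1 / 2"
    and mu_pos: "\<And>x. x > 0 \<Longrightarrow> \<mu> x > 0"
    and mu_continuous: "continuous_on {0<..} \<mu>"
    and U_finite: "\<And>x. x > 0 \<Longrightarrow> integrable (lebesgue_on {0<..x}) \<mu>"
    and U_infinity: "filterlim (primitive_U \<mu>) at_top at_top"
    and V_infinity: "filterlim (partial_V \<nu>) at_top sequentially"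
    and delta: "\<delta> \<in> {-1, 1}"
    and rho: "\<rho> > max 0 (- \<alpha>)"
    and gamma_sigma: "0 < \<gamma>" "\<gamma> < \<sigma>" "\<sigma> \<le> 1"
    and p: "p > 1"
    and conjugate: "1 / p + 1 / q = 1"
  shows
    "let K = csch_kernel \<alpha> \<rho> \<gamma> \<beta> \<delta> \<mu> \<nu>;
         \<Phi> = weight_Phi p \<sigma> \<delta> \<mu>;
         \<Psi> = weight_Psi q \<sigma> \<beta> \<nu>;
         \<Phi>' = (\<lambda>x. \<Phi> x powr (1 - q));
         \<Psi>' = (\<lambda>n. \<Psi> n powr (1 - p));
         T1_norm = (SUP f \<in> {f \<in> Lw p \<Phi>. \<not> (AE x in lebesgue_on {0<..}. f x = 0)}.
                      lw_norm p \<Psi>' (T1 K f) / Lw_norm p \<Phi> f);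
         T2_norm = (SUP a \<in> {a \<in> lw q \<Psi>. \<not> (\<forall>n\<ge>1. a n = 0)}.
                      Lw_norm q \<Phi>' (T2 K a) / lw_norm q \<Psi> a)
     in (\<forall>f \<in> Lw p \<Phi>. (\<forall>n\<ge>1. integrable (lebesgue_on {0<..}) (\<lambda>x. K x n * f x))
                        \<and> T1 K f \<in> lw p \<Psi>')
      \<and> (\<forall>f \<in> Lw p \<Phi>. \<forall>g \<in> Lw p \<Phi>. (AE x in lebesgue_on {0<..}. f x = g x)
                        \<longrightarrow> (\<forall>n\<ge>1. T1 K f n = T1 K g n))
      \<and> (\<exists>C. \<forall>f \<in> Lw p \<Phi>. lw_norm p \<Psi>' (T1 K f) \<le> C * Lw_norm p \<Phi> f)
      \<and> (\<forall>a \<in> lw q \<Psi>. (\<forall>x>0. summable (\<lambda>n. K x (Suc n) * a (Suc n)))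
                        \<and> T2 K a \<in> Lw q \<Phi>')
      \<and> (\<exists>C. \<forall>a \<in> lw q \<Psi>. Lw_norm q \<Phi>' (T2 K a) \<le> C * lw_norm q \<Psi> a)
      \<and> T1_norm = T2_norm
      \<and> T2_norm = k_const \<alpha> \<rho> \<gamma> \<sigma>
      \<and> k_const \<alpha> \<rho> \<gamma> \<sigma> =
          2 * Gamma (\<sigma> / \<gamma>) / (\<gamma> * (2 * \<rho>) powr (\<sigma> / \<gamma>))
            * hurwitz_zeta (\<sigma> / \<gamma>) ((\<alpha> + \<rho>) / (2 * \<rho>))"
proof -
  interpret csch_setting \<mu> \<alpha> \<rho> \<gamma> \<sigma> \<beta> \<delta> p q \<nu>
    by unfold_locales (fact assms)+
  show ?thesis
    unfolding Let_def
  proof (intro conjI)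
    show "\<forall>f \<in> Lw p \<Phi>. (\<forall>n\<ge>1. integrable M (\<lambda>x. K x n * f x)) \<and> T1 K f \<in> lw p \<Psi>'"
      using T1_bounded(1,2) by blast
    show "\<forall>f \<in> Lw p \<Phi>. \<forall>g \<in> Lw p \<Phi>. (AE x in M. f x = g x) \<longrightarrow> (\<forall>n\<ge>1. T1 K f n = T1 K g n)"
      using T1_cong_AE by blast
    show "\<exists>B. \<forall>f \<in> Lw p \<Phi>. lw_norm p \<Psi>' (T1 K f) \<le> B * Lw_norm p \<Phi> f"
      using T1_bounded(3) by blast
    show "\<forall>a \<in> lw q \<Psi>. (\<forall>x>0. summable (\<lambda>n. K x (Suc n) * a (Suc n))) \<and> T2 K a \<in> Lw q \<Phi>'"
      using T2_bounded(1) summable_rabs_cancel[OF T2_summable] by blast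
    show "\<exists>B. \<forall>a \<in> lw q \<Psi>. Lw_norm q \<Phi>' (T2 K a) \<le> B * lw_norm q \<Psi> a"
      using T2_bounded(2) by blast
    show "(SUP f \<in> {f \<in> Lw p \<Phi>. \<not> (AE x in M. f x = 0)}. lw_norm p \<Psi>' (T1 K f) / Lw_norm p \<Phi> f)
      = (SUP a \<in> {a \<in> lw q \<Psi>. \<not> (\<forall>n\<ge>1. a n = 0)}. Lw_norm q \<Phi>' (T2 K a) / lw_norm q \<Psi> a)"
      unfolding T1_norm_eq T2_norm_eq ..
    show "(SUP a \<in> {a \<in> lw q \<Psi>. \<not> (\<forall>n\<ge>1. a n = 0)}. Lw_norm q \<Phi>' (T2 K a) / lw_norm q \<Psi> a) = C"
      by (rule T2_norm_eq)
    show "C = 2 * Gamma (\<sigma> / \<gamma>) / (\<gamma> * (2 * \<rho>) powr (\<sigma> / \<gamma>)) * hurwitz_zeta (\<sigma> / \<gamma>) ((\<alpha> + \<rho>) / (2 * \<rho>))"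
      using integral_csch_exp(2)[OF rho gamma_sigma(1,2)] by (simp add: k_const_def csch_exp_def)
  qed
qed

end
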